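(* Assume that $\rho_f(x,y)=\gamma(y,f(x))+c(f)$, where $c(f)$ is a constant possibly depending on $f$, and that for some $D>0$, $|\gamma(y,f_\beta(x))-\gamma(y,f_{\tilde\beta}(x))|\le D|f_\beta(x)-f_{\tilde\beta}(x)|$ for all $(x,y)\in\mathcal X\times\mathcal Y$ and $\beta,\tilde\beta\in\Phi$; that $\frac1n\sum_{i=1}^n\max_{1\le j\le p}E\psi_j^2(X_i)\le1$ and $\max_{1\le j\le p}\|\psi_j\|_\infty\le K$ for a positive constant $K$; and that $p\ge2$ and $\log(p)\le n$. Then, with the choice $\lambda_0=dD\sqrt{\log(p)/n}$ for some positive constant $d$, the following holds. If $\lambda_1\ge8\lambda_0$ and (1) the margin condition holds with a strictly convex function $G$ (with convex conjugate $H$), i.e. $\Xi(f)\ge G(\|f-f^0\|)$ for all $f\in\mathbf F_{\text{local}}$; (2) $f^*\in\mathbf F_{\text{local}}$, and $f_\beta\in\mathbf F_{\text{local}}$ for all $\beta$ with $\|\beta-\beta^*\|_1\le M^*$; (3) the adaptive restricted eigenvalue condition holds for $S^*$, i.e. $\phi_*=\phi(S^* )>0$, then with probability at least $1-\frac1p$, $$\Xi(\hat f)+\lambda_1\|\hat\beta-\beta^*\|_1+\lambda_2\|\hat\beta_{S^*}-\beta^*_{S^*}\|_2^2\le4\Delta^*=6\,\Xi(f^* )+4H\!\left(\frac{4\lambda_1\sqrt{s^*}+4\lambda_2\|\beta^*\|_2}{\phi_*}\right).$$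
   Context: Setting. $Z_i=(X_i,Y_i)$, $i=1,\dots,n$, is an independent sample on a probability space $(\Omega,\mathcal F,P)$ with values in $\mathcal Z=\mathcal X\times\mathcal Y$, $\mathcal Y\subseteq\mathbb R$. $\mathbf F$ is a normed real vector space, with norm $\|\cdot\|$, of functions $f:\mathcal X\to\mathbb R$. For each $f\in\mathbf F$, $\rho_f:\mathcal Z\to\mathbb R$ is a loss function, and $f\mapsto\rho_f(z)$ is convex for every $z\in\mathcal Z$. Put $P_n\rho_f=\frac1n\sum_{i=1}^n\rho_f(Z_i)$ and $P\rho_f=\frac1n\sum_{i=1}^nE\rho_f(Z_i)$. The target is $f^0=\arg\min_{f\in\mathbf F}P\rho_f$, assumed to exist and be unique, and the excess risk is $\Xi(f)=P(\rho_f-\rho_{f^0})\ge0$. Given $\psi_1,\dots,\psi_p\in\mathbf F$, let $f_\beta=\sum_{j=1}^p\beta_j\psi_j$ for $\beta\in\mathbb R^p$. Let $\Phi\subseteq\mathbb R^p$ be convex. For $\lambda_1,\lambda_2>0$ the elastic net estimator is $\hat f=f_{\hat\beta}$, where $\hat\beta$ minimizes $P_n\rho_{f_\beta}+\lambda_1\|\beta\|_1+\lambda_2\|\beta\|_2^2$ over $\beta\in\Phi$. $\|f\|_\infty=\sup_{x\in\mathcal X}|f(x)|$, and $\mathbf F_{\text{local}}=\{f\in\mathbf F:\|f-f^0\|_\infty\le\eta\}$ for a given $\eta>0$. $G$ is a strictly convex function on $[0,\infty)$ with $G(0)=0$, and its convex conjugate is $H(v)=\sup_{u\ge0}\{uv-G(u)\}$,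 $v\ge0$. For $S\subseteq\{1,\dots,p\}$, $\beta_S$ denotes the vector with entries $\beta_j1_{\{j\in S\}}$, and $S^c$ is the complement of $S$. For $b\in\mathbb R^p$ let $S_b=\{j:b_j\ne0\}$, $s_b=|S_b|$. The adaptive restricted eigenvalue attached to $b$ and $S=S_b$ is given by $$\phi^2(S)=\min\Big\{\frac{\|f_\beta\|^2}{\|\beta_S\|_2^2}:\beta\in\mathbb R^p\setminus\{0\},\ \|\beta_{S^c}\|_1\le L_n\|\beta_S\|_2\Big\},\qquad L_n=3\Big(\sqrt{|S|}+\frac{2\lambda_2\|b_S\|_2}{\lambda_1}\Big),$$ with $b$ fixed in the minimization. Given a collection $\Gamma$ of subsets of $\{1,\dots,p\}$, the oracle is $$\beta^*=\arg\min_{\beta\in\mathbb R^p:\,S_\beta\in\Gamma}\Big\{3\,\Xi(f_\beta)+2H\Big(\frac{4\lambda_1\sqrt{s_\beta}+4\lambda_2\|\beta\|_2}{\phi(S_\beta)}\Big)\Big\}.$$ Put $S^*=S_{\beta^*}$, $s^*=|S^*|$, $\phi_*=\phi(S^* )$ (with $b=\beta^*$), $f^*=f_{\beta^*}$, and $$2\Delta^*=3\,\Xi(f^* )+2H\Big(\frac{4\lambda_1\sqrt{s^*}+4\lambda_2\|\beta^*\|_2}{\phi_*}\Big),\qquad M^*=\Delta^*/\lambda_0.$$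
   Formalization: The formal theorem additionally assumes that the oracle β* lies in Φ; without it the claim fails, e.g. Φ={0}, quadratic loss, f⁰=f_β with β≠0, D→0 and λ₁=λ₂=8λ₀, where Δ*→0 but Ξ(f̂)=Ξ(0)>0 stays fixed. *)

theory Defs
  imports "HOL-Probability.Probability"
begin

text \<open>
  The feature space is the type \<open>'x\<close>; function spaces over it are sets of functions
  \<open>'x \<Rightarrow> real\<close>. Since \<open>p\<close> has to be quantified inside the statement, a vector of dimension
  \<open>p\<close> is a function on \<open>nat\<close> that vanishes outside \<open>{1..p}\<close>.
\<close>

definition Rvec :: "nat \<Rightarrow> (nat \<Rightarrow> real) set"
  where "Rvec p = {\<beta>. \<forall>j. j \<notin> {1..p} \<longrightarrow> \<beta> j = 0}"

definition l1_norm :: "nat \<Rightarrow> (nat \<Rightarrow> real) \<Rightarrow> real"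
  where "l1_norm p \<beta> = (\<Sum>j=1..p. \<bar>\<beta> j\<bar>)"

definition l2_norm :: "nat \<Rightarrow> (nat \<Rightarrow> real) \<Rightarrow> real"
  where "l2_norm p \<beta> = L2_set \<beta> {1..p}"

definition restr :: "nat set \<Rightarrow> (nat \<Rightarrow> real) \<Rightarrow> nat \<Rightarrow> real"
  where "restr S \<beta> = (\<lambda>j. if j \<in> S then \<beta> j else 0)"

definition vsupp :: "nat \<Rightarrow> (nat \<Rightarrow> real) \<Rightarrow> nat set"
  where "vsupp p \<beta> = {j \<in> {1..p}. \<beta> j \<noteq> 0}"

definition lin_comb :: "nat \<Rightarrow> (nat \<Rightarrow> 'x \<Rightarrow> real) \<Rightarrow> (nat \<Rightarrow> real) \<Rightarrow> 'x \<Rightarrow> real"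
  where "lin_comb p \<psi> \<beta> = (\<lambda>x. \<Sum>j=1..p. \<beta> j * \<psi> j x)"

definition convex_vecs :: "(nat \<Rightarrow> real) set \<Rightarrow> bool"
  where "convex_vecs \<Phi> \<longleftrightarrow>
    (\<forall>\<beta>\<in>\<Phi>. \<forall>\<beta>'\<in>\<Phi>. \<forall>t\<in>{0..1}. (\<lambda>j. t * \<beta> j + (1 - t) * \<beta>' j) \<in> \<Phi>)"

text \<open>Real vector spaces of functions (pointwise operations) and norms on them.\<close>

definition function_space :: "('x \<Rightarrow> real) set \<Rightarrow> bool"
  where "function_space F \<longleftrightarrow>
    (\<lambda>x. 0) \<in> F \<and>
    (\<forall>f\<in>F. \<forall>g\<in>F. (\<lambda>x. f x + g x) \<in> F) \<and>
    (\<forall>a. \<forall>f\<in>F. (\<lambda>x. a * f x) \<in> F)"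

definition is_norm_on :: "('x \<Rightarrow> real) set \<Rightarrow> (('x \<Rightarrow> real) \<Rightarrow> real) \<Rightarrow> bool"
  where "is_norm_on F N \<longleftrightarrow>
    (\<forall>f\<in>F. 0 \<le> N f) \<and>
    (\<forall>f\<in>F. N f = 0 \<longleftrightarrow> f = (\<lambda>x. 0)) \<and>
    (\<forall>a. \<forall>f\<in>F. N (\<lambda>x. a * f x) = \<bar>a\<bar> * N f) \<and>
    (\<forall>f\<in>F. \<forall>g\<in>F. N (\<lambda>x. f x + g x) \<le> N f + N g)"

definition sup_norm :: "('x \<Rightarrow> real) \<Rightarrow> ereal"
  where "sup_norm f = (SUP x. ereal \<bar>f x\<bar>)"

definition F_local :: "('x \<Rightarrow> real) set \<Rightarrow> ('x \<Rightarrow> real) \<Rightarrow> real \<Rightarrow> ('x \<Rightarrow> real) set"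
  where "F_local F f0 \<eta> = {f \<in> F. sup_norm (\<lambda>x. f x - f0 x) \<le> ereal \<eta>}"

definition Pn :: "nat \<Rightarrow> (nat \<Rightarrow> 'w \<Rightarrow> 'z) \<Rightarrow> 'w \<Rightarrow> ('z \<Rightarrow> real) \<Rightarrow> real"
  where "Pn n Z \<omega> h = (\<Sum>i=1..n. h (Z i \<omega>)) / real n"

definition Pmean :: "'w measure \<Rightarrow> nat \<Rightarrow> (nat \<Rightarrow> 'w \<Rightarrow> 'z) \<Rightarrow> ('z \<Rightarrow> real) \<Rightarrow> real"
  where "Pmean M n Z h = (\<Sum>i=1..n. (\<integral>\<omega>. h (Z i \<omega>) \<partial>M)) / real n"

definition excess_risk ::
  "'w measure \<Rightarrow> nat \<Rightarrow> (nat \<Rightarrow> 'w \<Rightarrow> 'z) \<Rightarrow> ('f \<Rightarrow> 'z \<Rightarrow> real) \<Rightarrow> 'f \<Rightarrow> 'f \<Rightarrow> real"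
  where "excess_risk M n Z \<rho> f0 f = Pmean M n Z (\<lambda>z. \<rho> f z - \<rho> f0 z)"

definition strictly_convex_nonneg :: "(real \<Rightarrow> real) \<Rightarrow> bool"
  where "strictly_convex_nonneg G \<longleftrightarrow>
    (\<forall>u\<ge>0. \<forall>v\<ge>0. \<forall>t\<in>{0<..<1}. u \<noteq> v \<longrightarrow>
       G (t * u + (1 - t) * v) < t * G u + (1 - t) * G v)"

text \<open>
  The conjugate may be infinite, and it is evaluated at \<open>\<infinity>\<close> when the restricted eigenvalue
  vanishes; it is therefore defined on the extended reals.
\<close>

definition convex_conjugate :: "(real \<Rightarrow> real) \<Rightarrow> ereal \<Rightarrow> ereal"
  where "convex_conjugate G v = (SUP u\<in>{0..}. ereal u * v - ereal (G u))"

text \<open>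
  For \<open>vsupp p b \<noteq> {}\<close> the infimum below is a minimum. For \<open>b = 0\<close> it runs over the empty set
  and equals \<open>\<infinity>\<close>.
\<close>

definition adaptive_re_sq ::
  "(('x \<Rightarrow> real) \<Rightarrow> real) \<Rightarrow> nat \<Rightarrow> (nat \<Rightarrow> 'x \<Rightarrow> real) \<Rightarrow> real \<Rightarrow> real \<Rightarrow> (nat \<Rightarrow> real) \<Rightarrow> ereal"
  where "adaptive_re_sq N p \<psi> lam1 lam2 b =
    (let S = vsupp p b;
         L = 3 * (sqrt (real (card S)) + 2 * lam2 * l2_norm p (restr S b) / lam1)
     in INF \<beta> \<in> {\<beta> \<in> Rvec p. \<beta> \<noteq> (\<lambda>j. 0) \<and>
                    l1_norm p (restr (- S) \<beta>) \<le> L * l2_norm p (restr S \<beta>)}.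
          ereal ((N (lin_comb p \<psi> \<beta>))\<^sup>2 / (l2_norm p (restr S \<beta>))\<^sup>2))"

definition adaptive_re ::
  "(('x \<Rightarrow> real) \<Rightarrow> real) \<Rightarrow> nat \<Rightarrow> (nat \<Rightarrow> 'x \<Rightarrow> real) \<Rightarrow> real \<Rightarrow> real \<Rightarrow> (nat \<Rightarrow> real) \<Rightarrow> ereal"
  where "adaptive_re N p \<psi> lam1 lam2 b =
    (let q = adaptive_re_sq N p \<psi> lam1 lam2 b
     in if q = \<infinity> then \<infinity> else ereal (sqrt (real_of_ereal q)))"

text \<open>
  Division is that of \<^typ>\<open>ereal\<close>: \<open>a / 0 = \<infinity>\<close> for \<open>a > 0\<close> and \<open>a / \<infinity> = 0\<close>.
\<close>

definition conj_penalty ::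
  "(('x \<Rightarrow> real) \<Rightarrow> real) \<Rightarrow> (real \<Rightarrow> real) \<Rightarrow> nat \<Rightarrow> (nat \<Rightarrow> 'x \<Rightarrow> real) \<Rightarrow> real \<Rightarrow> real \<Rightarrow>
    (nat \<Rightarrow> real) \<Rightarrow> ereal"
  where "conj_penalty N G p \<psi> lam1 lam2 \<beta> =
    convex_conjugate G
      (ereal (4 * lam1 * sqrt (real (card (vsupp p \<beta>))) + 4 * lam2 * l2_norm p \<beta>)
         / adaptive_re N p \<psi> lam1 lam2 \<beta>)"

text \<open>
  Implicit in the notation of empirical process theory: the losses are measurable and
  integrable along the sample, so that every risk is a real number.
\<close>

locale convex_loss_model = prob_space M
  for M :: "'w measure" +
  fixes MX :: "'x measure"
    and Y :: "real set"
    and n :: nat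
    and Z :: "nat \<Rightarrow> 'w \<Rightarrow> 'x \<times> real"
    and F :: "('x \<Rightarrow> real) set"
    and N :: "('x \<Rightarrow> real) \<Rightarrow> real"
    and \<rho> :: "('x \<Rightarrow> real) \<Rightarrow> 'x \<times> real \<Rightarrow> real"
    and f0 :: "'x \<Rightarrow> real"
  assumes space_MX: "space MX = UNIV"
    and indep_sample: "indep_vars (\<lambda>_. MX \<Otimes>\<^sub>M restrict_space borel Y) Z {1..n}"
    and function_space: "function_space F"
    and norm_on: "is_norm_on F N"
    and loss_measurable:
      "\<And>f. f \<in> F \<Longrightarrow> \<rho> f \<in> borel_measurable (MX \<Otimes>\<^sub>M restrict_space borel Y)"
    and loss_integrable:
      "\<And>f i. f \<in> F \<Longrightarrow> i \<in> {1..n} \<Longrightarrow> integrable M (\<lambda>\<omega>. \<rho> f (Z i \<omega>))"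
    and loss_convex:
      "\<And>f g t z. f \<in> F \<Longrightarrow> g \<in> F \<Longrightarrow> t \<in> {0..1} \<Longrightarrow> z \<in> UNIV \<times> Y \<Longrightarrow>
         \<rho> (\<lambda>x. t * f x + (1 - t) * g x) z \<le> t * \<rho> f z + (1 - t) * \<rho> g z"
    and target: "is_arg_min (\<lambda>f. Pmean M n Z (\<rho> f)) (\<lambda>f. f \<in> F) f0"
    and target_unique:
      "\<And>g. is_arg_min (\<lambda>f. Pmean M n Z (\<rho> f)) (\<lambda>f. f \<in> F) g \<Longrightarrow> g = f0"

locale elastic_net = convex_loss_model M MX Y n Z F N \<rho> f0
  for M :: "'w measure" and MX :: "'x measure" and Y n Z F N \<rho> f0 +
  fixes p :: nat
    and \<psi> :: "nat \<Rightarrow> 'x \<Rightarrow> real"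
    and \<Phi> :: "(nat \<Rightarrow> real) set"
    and lam1 lam2 :: real
    and \<beta>hat :: "'w \<Rightarrow> nat \<Rightarrow> real"
  assumes dict: "\<And>j. j \<in> {1..p} \<Longrightarrow> \<psi> j \<in> F"
    and dict_measurable: "\<And>j. j \<in> {1..p} \<Longrightarrow> \<psi> j \<in> borel_measurable MX"
    and params: "\<Phi> \<subseteq> Rvec p" "convex_vecs \<Phi>"
    and tuning_pos: "lam1 > 0" "lam2 > 0"
    and estimator:
      "\<And>\<omega>. \<omega> \<in> space M \<Longrightarrow>
         is_arg_min
           (\<lambda>\<beta>. Pn n Z \<omega> (\<rho> (lin_comb p \<psi> \<beta>)) + lam1 * l1_norm p \<beta> + lam2 * (l2_norm p \<beta>)\<^sup>2)
           (\<lambda>\<beta>. \<beta> \<in> \<Phi>) (\<beta>hat \<omega>)"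

end

theory Submission
  imports Defs
begin

text \<open>
  The deterministic part is an argument on the segment from \<open>\<beta>\<^sup>*\<close> to the estimator: by convexity the
  point of it at \<open>\<ell>\<^sub>1\<close>-distance below \<open>M\<^sup>*\<close> from \<open>\<beta>\<^sup>*\<close> satisfies the basic inequality, the restricted
  eigenvalue and the inequality \<open>u v \<le> G u + H v\<close> bound its distance by \<open>M\<^sup>* / 2\<close>, hence the estimator itself
  lies in the \<open>M\<^sup>*\<close>-ball and the argument applies to it.

  It remains to bound \<open>(P - P\<^sub>n) (\<rho>\<^sub>\<beta> - \<rho>\<^sub>\<beta>\<^sub>*)\<close> by \<open>\<lambda>\<^sub>0 M\<^sup>*\<close> uniformly over the ball. Its exponential moment is
  controlled one observation at a time, by symmetrization and contraction, with an exponent that is linear in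
  \<open>\<beta> - \<beta>\<^sup>*\<close> as induction invariant. This leads to \<open>\<Sum>\<^sub>j 2 cosh\<close>, that is to \<open>2 p\<close> times a sub-Gaussian factor,
  so that Markov's inequality suffices and \<open>d = 5 K\<close> works. A countable dense subset of the ball removes the
  finiteness of the index set.

  When \<open>\<Delta>\<^sup>* = 0\<close> the ball is a point and carries no information; then \<open>f\<^sup>* = f\<^sup>0\<close>, small balls around \<open>\<beta>\<^sup>*\<close> are
  local by boundedness of the dictionary, and the claim follows on the limes superior of the events for
  radii tending to \<open>0\<close>.
\<close>

section \<open>Exponential moments of empirical processes\<close>

text \<open>Hoeffding's bound for a fair sign: the auxiliary inequality with step
  \<open>2 * x\<close> and mass \<open>1 / 2\<close>, after factoring out \<open>exp x\<close>. It
  treats nonnegative \<open>x\<close>; the other half follows because \<open>cosh\<close> is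
  even.\<close>

lemma cosh_le_exp_square: "cosh x \<le> exp (x\<^sup>2 / 2)" for x :: real
proof -
  have nonneg: "cosh x \<le> exp (x\<^sup>2 / 2)" if "x \<ge> 0" for x :: real
  proof -
    have "- (2 * x) * (1 / 2) + ln (1 + (1 / 2) * (exp (2 * x) - 1)) \<le> (2 * x)\<^sup>2 / 8"
      using that by (intro Hoeffdings_lemma_aux) auto
    moreover have "1 + (1 / 2) * (exp (2 * x) - 1) = exp x * cosh x"
      by (simp add: cosh_field_def field_simps flip: exp_add)
    moreover have "ln (exp x * cosh x) = x + ln (cosh x)"
      by (simp add: ln_mult cosh_real_pos)
    ultimately have "ln (cosh x) \<le> x\<^sup>2 / 2"
      by (simp add: power2_eq_square)
    then show ?thesis
      by (metis cosh_real_pos exp_le_cancel_iff exp_ln)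
  qed
  show ?thesis
    using nonneg[of x] nonneg[of "- x"] by (cases "x \<ge> 0") auto
qed

text \<open>An increasing convex function respects weak majorization. After sorting, the only case
  that monotonicity does not settle is \<open>b < y\<close>; there the tangents at \<open>y\<close>
  and at \<open>x\<close> compare, since \<open>y - b \<le> a - x\<close>.\<close>

lemma exp_weak_majorization:
  fixes x y a b :: real
  assumes "x \<le> max a b" "y \<le> max a b" "x + y \<le> a + b"
  shows "exp x + exp y \<le> exp a + exp b"
proof -
  have *: "exp x + exp y \<le> exp a + exp b"
    if "y \<le> x" "x \<le> a" "x + y \<le> a + b" for x y a b :: real
  proof (cases "y \<le> b")
    case True
    then show ?thesis using that by (intro add_mono) auto
  next
    case False
    have tangent: "exp u * (v - u) \<le> exp v - exp u" for u v :: real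
    proof -
      have "exp u * (1 + (v - u)) \<le> exp u * exp (v - u)"
        by (intro mult_left_mono exp_ge_add_one_self) auto
      then show ?thesis by (simp add: algebra_simps flip: exp_add)
    qed
    have "exp y - exp b \<le> exp y * (y - b)"
      using tangent[of y b] by (simp add: algebra_simps)
    also have "\<dots> \<le> exp x * (a - x)"
      using that False by (intro mult_mono) auto
    also have "\<dots> \<le> exp a - exp x" by (rule tangent)
    finally show ?thesis by simp
  qed
  show ?thesis
    using *[of x y a b] *[of x y b a] *[of y x a b] *[of y x b a] assms
    by (cases "y \<le> x"; cases "a \<le> b") (auto simp: max_def add.commute)
qed

section \<open>Contraction and symmetrization of one observation\<close>

lemma Max_attained:
  assumes "finite T" "T \<noteq> {}"
  obtains t where "t \<in> T" "(MAX t\<in>T. h t) = h t"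
proof -
  have "(MAX t\<in>T. h t) \<in> h ` T"
    using assms by (intro Max_in) auto
  then show ?thesis using that by auto
qed

text \<open>The contraction principle for a single random sign, in exponential form and up to the
  factor \<open>1 / 2\<close>. Pointwise, \<open>2 * g t\<close> is at most \<open>2 * u t\<close>
  or \<open>- 2 * u t\<close>, which bounds either maximum on the left by the larger one on the
  right. For the sum, the maximizers \<open>t\<close> and \<open>s\<close> keep or exchange their
  places according to the sign of \<open>u t - u s\<close>.\<close>

lemma Max_contraction:
  fixes a g u :: "'t \<Rightarrow> real"
  assumes T: "finite T" "T \<noteq> {}"
    and g: "\<And>t. t \<in> T \<Longrightarrow> \<bar>g t\<bar> \<le> \<bar>u t\<bar>"
      "\<And>s t. s \<in> T \<Longrightarrow> t \<in> T \<Longrightarrow> \<bar>g s - g t\<bar> \<le> \<bar>u s - u t\<bar>"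
  shows "exp (MAX t\<in>T. a t + 2 * g t) + exp (MAX t\<in>T. a t - 2 * g t)
    \<le> exp (MAX t\<in>T. a t + 2 * u t) + exp (MAX t\<in>T. a t - 2 * u t)"
proof (rule exp_weak_majorization)
  let ?U = "MAX t\<in>T. a t + 2 * u t" and ?V = "MAX t\<in>T. a t - 2 * u t"
  have UV: "a t + 2 * u t \<le> ?U" "a t - 2 * u t \<le> ?V" if "t \<in> T" for t
    using T that by (auto intro!: Max_ge)
  obtain t where t: "t \<in> T" "(MAX t\<in>T. a t + 2 * g t) = a t + 2 * g t"
    using T by (rule Max_attained)
  obtain s where s: "s \<in> T" "(MAX t\<in>T. a t - 2 * g t) = a s - 2 * g s"
    using T by (rule Max_attained)
  show "(MAX t\<in>T. a t + 2 * g t) \<le> max ?U ?V"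
    unfolding t using g(1)[OF t(1)] UV[OF t(1)] by (auto simp: abs_if split: if_splits)
  show "(MAX t\<in>T. a t - 2 * g t) \<le> max ?U ?V"
    unfolding s using g(1)[OF s(1)] UV[OF s(1)] by (auto simp: abs_if split: if_splits)
  show "(MAX t\<in>T. a t + 2 * g t) + (MAX t\<in>T. a t - 2 * g t) \<le> ?U + ?V"
    unfolding t s using g(2)[OF t(1) s(1)] UV[OF t(1)] UV[OF s(1)]
    by (auto simp: abs_if split: if_splits)
qed

text \<open>
  No independent copy of the sample is needed: the maximum is at most the mean of \<open>MAX (a + 2 E g)\<close> and
  \<open>MAX (a - 2 g)\<close>, and Jensen's inequality replaces the expectation in the former.
\<close>

lemma (in prob_space) nn_integral_exp_Max_symmetrize:
  fixes a :: "'t \<Rightarrow> real" and g u :: "'t \<Rightarrow> 'a \<Rightarrow> real"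
  assumes T: "finite T" "T \<noteq> {}"
    and meas [measurable]: "\<And>t. t \<in> T \<Longrightarrow> g t \<in> borel_measurable M"
    and bound: "\<And>t z. t \<in> T \<Longrightarrow> z \<in> space M \<Longrightarrow> \<bar>g t z\<bar> \<le> B"
    and g: "\<And>t z. t \<in> T \<Longrightarrow> z \<in> space M \<Longrightarrow> \<bar>g t z\<bar> \<le> \<bar>u t z\<bar>"
      "\<And>s t z. s \<in> T \<Longrightarrow> t \<in> T \<Longrightarrow> z \<in> space M \<Longrightarrow> \<bar>g s z - g t z\<bar> \<le> \<bar>u s z - u t z\<bar>"
  shows "(\<integral>\<^sup>+z. exp (MAX t\<in>T. a t + (expectation (g t) - g t z)) \<partial>M)
    \<le> (\<integral>\<^sup>+z. (exp (MAX t\<in>T. a t + 2 * u t z) + exp (MAX t\<in>T. a t - 2 * u t z)) / 2 \<partial>M)"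
proof -
  define c where "c = (MAX t\<in>T. a t + 2 * expectation (g t))"
  define P where "P z = (MAX t\<in>T. a t + 2 * g t z)" for z
  define Q where "Q z = (MAX t\<in>T. a t - 2 * g t z)" for z
  have [measurable]: "P \<in> borel_measurable M" "Q \<in> borel_measurable M"
    unfolding P_def Q_def using T by measurable
  have P: "a t + 2 * g t z \<le> P z" and Q: "a t - 2 * g t z \<le> Q z"
    and c: "a t + 2 * expectation (g t) \<le> c" if "t \<in> T" for t z
    using T that by (auto simp: P_def Q_def c_def intro!: Max_ge)
  have "exp (MAX t\<in>T. a t + (expectation (g t) - g t z)) \<le> (exp c + exp (Q z)) / 2" for z
  proof -
    obtain t where t: "t \<in> T"
      "(MAX t\<in>T. a t + (expectation (g t) - g t z)) = a t + (expectation (g t) - g t z)"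
      using T by (rule Max_attained)
    have "exp (MAX t\<in>T. a t + (expectation (g t) - g t z)) \<le> exp ((c + Q z) / 2)"
      unfolding t using c[OF t(1)] Q[OF t(1), of z] by simp
    \<comment> \<open>Midpoint convexity of \<open>exp\<close>, as majorization of two equal
      entries.\<close>
    also have "2 * \<dots> \<le> exp c + exp (Q z)"
      using exp_weak_majorization[of "(c + Q z) / 2" c "Q z" "(c + Q z) / 2"]
      by (simp add: max_def field_simps)
    finally show ?thesis by simp
  qed
  then have "(\<integral>\<^sup>+z. exp (MAX t\<in>T. a t + (expectation (g t) - g t z)) \<partial>M)
      \<le> (\<integral>\<^sup>+z. ennreal ((exp c + exp (Q z)) / 2) \<partial>M)"
    by (intro nn_integral_mono ennreal_leI)
  also have "\<dots> = (\<integral>\<^sup>+z. ennreal (exp c / 2) + ennreal (exp (Q z) / 2) \<partial>M)"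
    by (intro nn_integral_cong) (simp add: add_divide_distrib)
  also have "\<dots> = ennreal (exp c / 2) + (\<integral>\<^sup>+z. ennreal (exp (Q z) / 2) \<partial>M)"
    by (subst nn_integral_add) (auto simp: emeasure_space_1)
  \<comment> \<open>\<open>c\<close> is attained at one fixed \<open>t\<close>, so Jensen's
    inequality is applied to the exponential of \<open>g t\<close> alone, which \<open>P\<close>
    dominates afterwards.\<close>
  also have "ennreal (exp c / 2) \<le> (\<integral>\<^sup>+z. ennreal (exp (P z) / 2) \<partial>M)"
  proof -
    obtain t where t: "t \<in> T" "c = a t + 2 * expectation (g t)"
      using T unfolding c_def by (rule Max_attained)
    note [measurable] = meas[OF t(1)]
    have int: "integrable M (g t)"
      using bound[OF t(1)] by (intro integrable_const_bound[where B = B]) auto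
    have int': "integrable M (\<lambda>z. exp (a t + 2 * g t z) / 2)"
      using bound[OF t(1)]
      by (intro integrable_const_bound[where B = "exp (a t + 2 * B) / 2"]) (auto simp: abs_le_iff)
    have "convex_on UNIV (\<lambda>x. exp (a t + 2 * x) / 2)"
      by (rule f''_ge0_imp_convex[where f' = "\<lambda>x. exp (a t + 2 * x)" and f'' = "\<lambda>x. 2 * exp (a t + 2 * x)"])
         (auto intro!: derivative_eq_intros)
    from jensens_inequality[OF int _ _ int' this]
    have "exp c / 2 \<le> expectation (\<lambda>z. exp (a t + 2 * g t z) / 2)"
      unfolding t by simp
    then have "ennreal (exp c / 2) \<le> ennreal (expectation (\<lambda>z. exp (a t + 2 * g t z) / 2))"
      by (rule ennreal_leI)
    also have "\<dots> = (\<integral>\<^sup>+z. exp (a t + 2 * g t z) / 2 \<partial>M)"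
      by (rule nn_integral_eq_integral[symmetric, OF int']) auto
    also have "\<dots> \<le> (\<integral>\<^sup>+z. ennreal (exp (P z) / 2) \<partial>M)"
      using P[OF t(1)] by (intro nn_integral_mono ennreal_leI) simp
    finally show ?thesis .
  qed
  also have "(\<integral>\<^sup>+z. ennreal (exp (P z) / 2) \<partial>M) + (\<integral>\<^sup>+z. ennreal (exp (Q z) / 2) \<partial>M)
      = (\<integral>\<^sup>+z. ennreal ((exp (P z) + exp (Q z)) / 2) \<partial>M)"
    by (subst nn_integral_add[symmetric]) (auto simp: add_divide_distrib)
  \<comment> \<open>\<open>(exp (P z) + exp (Q z)) / 2\<close> is an average over a fair sign, so
    contraction applies for each \<open>z\<close> separately.\<close>
  also have "\<dots> \<le> (\<integral>\<^sup>+z. (exp (MAX t\<in>T. a t + 2 * u t z) + exp (MAX t\<in>T. a t - 2 * u t z)) / 2 \<partial>M)"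
    unfolding P_def Q_def
    by (intro nn_integral_mono ennreal_leI divide_right_mono Max_contraction T g) auto
  finally show ?thesis by (simp add: add_right_mono)
qed

text \<open>Duality of the l1 and sup norms bounds the linear form by
  \<open>B * \<bar>c k\<bar>\<close> at a largest coordinate, and
  \<open>exp \<bar>x\<bar> \<le> 2 * cosh x\<close>. Here the maximum over \<open>T\<close> turns
  into a sum over coordinates, whatever the size of \<open>T\<close>.\<close>

lemma exp_Max_linear_le:
  fixes c :: "'j \<Rightarrow> real"
  assumes T: "finite T" "T \<noteq> {}" and J: "finite J" "J \<noteq> {}"
    and b: "\<And>t. t \<in> T \<Longrightarrow> (\<Sum>j\<in>J. \<bar>b t j\<bar>) \<le> B"
  shows "exp (MAX t\<in>T. \<Sum>j\<in>J. b t j * c j) \<le> (\<Sum>j\<in>J. 2 * cosh (B * c j))"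
proof -
  obtain t where t: "t \<in> T" "(MAX t\<in>T. \<Sum>j\<in>J. b t j * c j) = (\<Sum>j\<in>J. b t j * c j)"
    using T by (rule Max_attained)
  obtain k where k: "k \<in> J" "(MAX j\<in>J. \<bar>c j\<bar>) = \<bar>c k\<bar>"
    using J by (rule Max_attained)
  have ck: "\<bar>c j\<bar> \<le> \<bar>c k\<bar>" if "j \<in> J" for j
    using J that unfolding k(2)[symmetric] by auto
  have "(\<Sum>j\<in>J. b t j * c j) \<le> (\<Sum>j\<in>J. \<bar>b t j\<bar> * \<bar>c k\<bar>)"
  proof (intro sum_mono)
    fix j assume "j \<in> J"
    have "b t j * c j \<le> \<bar>b t j\<bar> * \<bar>c j\<bar>" by (metis abs_ge_self abs_mult)
    also have "\<dots> \<le> \<bar>b t j\<bar> * \<bar>c k\<bar>"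
      using ck[OF \<open>j \<in> J\<close>] by (intro mult_left_mono) auto
    finally show "b t j * c j \<le> \<bar>b t j\<bar> * \<bar>c k\<bar>" .
  qed
  also have "\<dots> \<le> B * \<bar>c k\<bar>"
    using b[OF t(1)] by (simp add: mult_right_mono flip: sum_distrib_right)
  finally have "exp (\<Sum>j\<in>J. b t j * c j) \<le> exp (B * \<bar>c k\<bar>)" by simp
  also have "\<dots> \<le> 2 * cosh (B * c k)"
    by (simp add: cosh_field_def abs_if)
  also have "\<dots> \<le> (\<Sum>j\<in>J. 2 * cosh (B * c j))"
    using J k by (intro member_le_sum) (auto simp: cosh_real_nonneg)
  finally show ?thesis using t by simp
qed

text \<open>Induction over the observations, with the linear form given by \<open>c\<close> left
  free. Symmetrizing one observation adds a term that is again linear in \<open>b t\<close>, so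
  \<open>c\<close> is shifted by plus or minus \<open>2 * \<psi> j\<close> and the induction
  hypothesis applies to both shifts. Averaging them costs only the factor
  \<open>exp (2 * (B * K)\<^sup>2)\<close>.\<close>

lemma nn_integral_exp_Max_PiM_le:
  fixes \<mu> :: "'i \<Rightarrow> 'z measure" and g :: "'t \<Rightarrow> 'z \<Rightarrow> real"
    and \<psi> :: "'j \<Rightarrow> 'z \<Rightarrow> real" and b :: "'t \<Rightarrow> 'j \<Rightarrow> real" and c :: "'j \<Rightarrow> real"
  assumes \<mu>: "\<And>i. prob_space (\<mu> i)" "\<And>i. sets (\<mu> i) = sets S" and I: "finite I"
    and T: "finite T" "T \<noteq> {}" and J: "finite J" "J \<noteq> {}"
    and meas: "\<And>t. t \<in> T \<Longrightarrow> g t \<in> borel_measurable S"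
      "\<And>j. j \<in> J \<Longrightarrow> \<psi> j \<in> borel_measurable S"
    and K: "\<And>j z. j \<in> J \<Longrightarrow> z \<in> space S \<Longrightarrow> \<bar>\<psi> j z\<bar> \<le> K"
    and b: "\<And>t. t \<in> T \<Longrightarrow> (\<Sum>j\<in>J. \<bar>b t j\<bar>) \<le> B"
    and g: "\<And>t z. t \<in> T \<Longrightarrow> z \<in> space S \<Longrightarrow> \<bar>g t z\<bar> \<le> \<bar>\<Sum>j\<in>J. b t j * \<psi> j z\<bar>"
      "\<And>s t z. s \<in> T \<Longrightarrow> t \<in> T \<Longrightarrow> z \<in> space S \<Longrightarrow>
        \<bar>g s z - g t z\<bar> \<le> \<bar>(\<Sum>j\<in>J. b s j * \<psi> j z) - (\<Sum>j\<in>J. b t j * \<psi> j z)\<bar>"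
  shows "(\<integral>\<^sup>+z. exp (MAX t\<in>T. (\<Sum>j\<in>J. b t j * c j) + (\<Sum>i\<in>I. (\<integral>x. g t x \<partial>\<mu> i) - g t (z i))) \<partial>PiM I \<mu>)
    \<le> (\<Sum>j\<in>J. 2 * cosh (B * c j)) * exp (2 * (B * K)\<^sup>2) ^ card I"
  using I
proof (induction I arbitrary: c)
  case empty
  have "(\<integral>\<^sup>+z. exp (MAX t\<in>T. (\<Sum>j\<in>J. b t j * c j) + (\<Sum>i\<in>{}. (\<integral>x. g t x \<partial>\<mu> i) - g t (z i))) \<partial>PiM {} \<mu>)
    = exp (MAX t\<in>T. \<Sum>j\<in>J. b t j * c j)"
    by (simp add: PiM_empty nn_integral_count_space_finite)
  also have "\<dots> \<le> ennreal (\<Sum>j\<in>J. 2 * cosh (B * c j))"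
    by (intro ennreal_leI exp_Max_linear_le T J b)
  finally show ?case by simp
next
  case (insert i I)
  interpret product_sigma_finite \<mu>
    by (rule product_sigma_finite.intro) (simp add: \<mu>(1) prob_space_imp_sigma_finite)
  interpret i: prob_space "\<mu> i" by (rule \<mu>)
  define \<Lambda> where "\<Lambda> c t = (\<Sum>j\<in>J. b t j * c j)" for c t
  define u where "u t z = (\<Sum>j\<in>J. b t j * \<psi> j z)" for t z
  define R where "R z t = (\<Sum>i\<in>I. (\<integral>x. g t x \<partial>\<mu> i) - g t (z i))" for z t
  \<comment> \<open>The symmetrized integrand, written on the larger product so that the order of
    integration can be exchanged.\<close>
  define G where "G z = ennreal ((exp (MAX t\<in>T. \<Lambda> c t + R z t + 2 * u t (z i))
      + exp (MAX t\<in>T. \<Lambda> c t + R z t - 2 * u t (z i))) / 2)" for z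
  let ?A = "\<lambda>c. \<Sum>j\<in>J. 2 * cosh (B * c j)" and ?q = "exp (2 * (B * K)\<^sup>2)"
  have space_\<mu>: "space (\<mu> i) = space S" for i
    using \<mu>(2) by (rule sets_eq_imp_space_eq)
  have [measurable]: "g t \<in> borel_measurable (\<mu> i)" if "t \<in> T" for t i
    using meas(1)[OF that] measurable_cong_sets[OF \<mu>(2) refl] by blast
  have [measurable]: "u t \<in> borel_measurable (\<mu> i)" for t i
  proof -
    have "u t \<in> borel_measurable S"
      unfolding u_def using meas(2) by measurable
    then show ?thesis using measurable_cong_sets[OF \<mu>(2) refl] by blast
  qed
  have R: "R (z(i := y)) = R z" for z y
    using insert.hyps(2) by (intro ext) (auto simp: R_def intro!: sum.cong)
  have [measurable]: "(\<lambda>z. R z t) \<in> borel_measurable (PiM (insert i I) \<mu>)" if "t \<in> T" for t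
    unfolding R_def using that by measurable
  have G_meas: "G \<in> borel_measurable (PiM (insert i I) \<mu>)"
    unfolding G_def using T by measurable
  have "(\<integral>\<^sup>+z. exp (MAX t\<in>T. \<Lambda> c t + (\<Sum>i\<in>insert i I. (\<integral>x. g t x \<partial>\<mu> i) - g t (z i))) \<partial>PiM (insert i I) \<mu>)
     = (\<integral>\<^sup>+z. exp (MAX t\<in>T. \<Lambda> c t + R z t + (i.expectation (g t) - g t (z i))) \<partial>PiM (insert i I) \<mu>)"
    using insert.hyps by (simp add: R_def add_ac)
  also have "\<dots> = (\<integral>\<^sup>+z. \<integral>\<^sup>+y. exp (MAX t\<in>T. \<Lambda> c t + R z t + (i.expectation (g t) - g t y)) \<partial>\<mu> i \<partial>PiM I \<mu>)"
    using insert.hyps T by (subst product_nn_integral_insert) (auto simp: R)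
  \<comment> \<open>With the other observations fixed, their contribution \<open>R z t\<close>
    belongs to the deterministic offset.\<close>
  also have "\<dots> \<le> (\<integral>\<^sup>+z. \<integral>\<^sup>+y. G (z(i := y)) \<partial>\<mu> i \<partial>PiM I \<mu>)"
  proof (rule nn_integral_mono)
    fix z
    show "(\<integral>\<^sup>+y. exp (MAX t\<in>T. \<Lambda> c t + R z t + (i.expectation (g t) - g t y)) \<partial>\<mu> i)
      \<le> (\<integral>\<^sup>+y. G (z(i := y)) \<partial>\<mu> i)"
      unfolding G_def R fun_upd_same
    proof (rule i.nn_integral_exp_Max_symmetrize[OF T, where B = "B * K"])
      fix t y assume t: "t \<in> T" and y: "y \<in> space (\<mu> i)"
      have "\<bar>g t y\<bar> \<le> \<bar>u t y\<bar>"
        using g(1)[OF t] y by (simp add: u_def space_\<mu>)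
      also have "\<dots> \<le> (\<Sum>j\<in>J. \<bar>b t j\<bar> * K)"
        unfolding u_def using K y
        by (intro order_trans[OF sum_abs] sum_mono) (auto simp: abs_mult space_\<mu> intro!: mult_left_mono)
      also have "\<dots> \<le> B * K"
      proof -
        from J(2) obtain j where "j \<in> J" by auto
        then have "0 \<le> K" using K[of j y] y by (auto simp: space_\<mu>)
        then show ?thesis
          using b[OF t] by (simp add: mult_right_mono flip: sum_distrib_right)
      qed
      finally show "\<bar>g t y\<bar> \<le> B * K" .
    next
      fix t assume "t \<in> T"
      then show "g t \<in> borel_measurable (\<mu> i)" by simp
    next
      fix t y assume "t \<in> T" "y \<in> space (\<mu> i)"
      then show "\<bar>g t y\<bar> \<le> \<bar>u t y\<bar>"
        using g(1) by (simp add: u_def space_\<mu>)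
    next
      fix s t y assume "s \<in> T" "t \<in> T" "y \<in> space (\<mu> i)"
      then show "\<bar>g s y - g t y\<bar> \<le> \<bar>u s y - u t y\<bar>"
        using g(2) by (simp add: u_def space_\<mu>)
    qed
  qed
  also have "\<dots> = (\<integral>\<^sup>+z. G z \<partial>PiM (insert i I) \<mu>)"
    using insert.hyps G_meas by (intro product_nn_integral_insert[symmetric])
  \<comment> \<open>Now the new observation is frozen as \<open>y\<close> and the old ones are
    integrated, which is what the induction hypothesis controls.\<close>
  also have "\<dots> = (\<integral>\<^sup>+y. \<integral>\<^sup>+z. G (z(i := y)) \<partial>PiM I \<mu> \<partial>\<mu> i)"
    using insert.hyps G_meas by (intro product_nn_integral_insert_rev)
  also have "\<dots> \<le> (\<integral>\<^sup>+y. ennreal (?A c * ?q ^ card (insert i I)) \<partial>\<mu> i)"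
  proof (rule nn_integral_mono)
    fix y assume y: "y \<in> space (\<mu> i)"
    define cp cm where "cp j = c j + 2 * \<psi> j y" and "cm j = c j - 2 * \<psi> j y" for j
    have \<Lambda>: "\<Lambda> c t + r + 2 * u t y = \<Lambda> cp t + r" "\<Lambda> c t + r - 2 * u t y = \<Lambda> cm t + r" for t r
      by (simp_all add: \<Lambda>_def u_def cp_def cm_def algebra_simps sum.distrib sum_subtractf sum_distrib_left)
    have [measurable]: "(\<lambda>z. R z t) \<in> borel_measurable (PiM I \<mu>)" if "t \<in> T" for t
      unfolding R_def using that by measurable
    have nonneg: "0 \<le> ?A c * ?q ^ card I" for c
      by (intro mult_nonneg_nonneg sum_nonneg) (simp_all add: cosh_real_nonneg)
    have "(\<integral>\<^sup>+z. G (z(i := y)) \<partial>PiM I \<mu>)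
      = (\<integral>\<^sup>+z. (ennreal (exp (MAX t\<in>T. \<Lambda> cp t + R z t)) + ennreal (exp (MAX t\<in>T. \<Lambda> cm t + R z t))) / 2 \<partial>PiM I \<mu>)"
      unfolding G_def R fun_upd_same \<Lambda>
      by (intro nn_integral_cong) (simp add: ennreal_divide_numeral flip: ennreal_plus)
    also have "\<dots> = ((\<integral>\<^sup>+z. exp (MAX t\<in>T. \<Lambda> cp t + R z t) \<partial>PiM I \<mu>)
        + (\<integral>\<^sup>+z. exp (MAX t\<in>T. \<Lambda> cm t + R z t) \<partial>PiM I \<mu>)) / 2"
      using T by (simp add: nn_integral_divide nn_integral_add)
    also have "\<dots> \<le> (ennreal (?A cp * ?q ^ card I) + ennreal (?A cm * ?q ^ card I)) / 2"
      unfolding \<Lambda>_def R_def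
      by (intro divide_right_mono_ennreal add_mono insert.IH)
    also have "\<dots> = ennreal ((?A cp * ?q ^ card I + ?A cm * ?q ^ card I) / 2)"
      using nonneg[of cp] nonneg[of cm] by (simp add: ennreal_divide_numeral flip: ennreal_plus)
    also have "(?A cp * ?q ^ card I + ?A cm * ?q ^ card I) / 2 = (?A cp + ?A cm) / 2 * ?q ^ card I"
      by (simp add: algebra_simps)
    also have "ennreal \<dots> \<le> ennreal (?A c * ?q * ?q ^ card I)"
    proof (intro ennreal_leI mult_right_mono)
      \<comment> \<open>The addition formula: the mixed \<open>sinh\<close> terms cancel between the
        two shifts.\<close>
      have "(?A cp + ?A cm) / 2 = (\<Sum>j\<in>J. 2 * cosh (B * c j) * cosh (B * (2 * \<psi> j y)))"
        unfolding sum.distrib[symmetric] sum_divide_distrib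
        by (intro sum.cong) (simp_all add: cp_def cm_def distrib_left right_diff_distrib cosh_add cosh_diff)
      also have "\<dots> \<le> (\<Sum>j\<in>J. 2 * cosh (B * c j) * ?q)"
      proof (intro sum_mono mult_left_mono)
        fix j assume "j \<in> J"
        then have "\<bar>\<psi> j y\<bar> \<le> K"
          using K y by (simp add: space_\<mu>)
        then have "(\<psi> j y)\<^sup>2 \<le> K\<^sup>2"
          by (metis abs_ge_zero abs_le_square_iff abs_of_nonneg order_trans)
        then have "(B * (2 * \<psi> j y))\<^sup>2 / 2 \<le> 2 * (B * K)\<^sup>2"
          by (simp add: power_mult_distrib mult_left_mono)
        then show "cosh (B * (2 * \<psi> j y)) \<le> ?q"
          by (intro order_trans[OF cosh_le_exp_square]) simp
      qed (simp add: cosh_real_nonneg)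
      finally show "(?A cp + ?A cm) / 2 \<le> ?A c * ?q"
        by (simp add: sum_distrib_right)
    qed simp
    also have "?A c * ?q * ?q ^ card I = ?A c * ?q ^ card (insert i I)"
      using insert.hyps by simp
    finally show "(\<integral>\<^sup>+z. G (z(i := y)) \<partial>PiM I \<mu>) \<le> ennreal (?A c * ?q ^ card (insert i I))" .
  qed
  also have "\<dots> = ennreal (?A c * ?q ^ card (insert i I))"
    by (simp add: i.emeasure_space_1)
  finally show ?case by (simp add: \<Lambda>_def)
qed

text \<open>Chernoff's method: Markov's inequality for the exponential of \<open>l\<close> times the
  maximum, with \<open>l * D\<close> absorbed into the coefficients \<open>b\<close>. The moment
  bound starts from the zero linear form, where each \<open>cosh\<close> is \<open>1\<close>; hence
  the prefactor \<open>2 * real (card J)\<close>, independent of \<open>T\<close>.\<close>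

lemma (in prob_space) prob_deviation_finite_le:
  fixes Z :: "'i \<Rightarrow> 'a \<Rightarrow> 'z" and g :: "'t \<Rightarrow> 'z \<Rightarrow> real"
    and \<psi> :: "'j \<Rightarrow> 'z \<Rightarrow> real" and b :: "'t \<Rightarrow> 'j \<Rightarrow> real"
  assumes indep: "indep_vars (\<lambda>_. S) Z I" and I: "finite I" "I \<noteq> {}"
    and T: "finite T" and J: "finite J" "J \<noteq> {}"
    and meas: "\<And>t. t \<in> T \<Longrightarrow> g t \<in> borel_measurable S"
      "\<And>j. j \<in> J \<Longrightarrow> \<psi> j \<in> borel_measurable S"
    and K: "\<And>j z. j \<in> J \<Longrightarrow> z \<in> space S \<Longrightarrow> \<bar>\<psi> j z\<bar> \<le> K" "K > 0"
    and b: "\<And>t. t \<in> T \<Longrightarrow> (\<Sum>j\<in>J. \<bar>b t j\<bar>) \<le> B" "B > 0" and D: "D > 0"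
    and g: "\<And>t z. t \<in> T \<Longrightarrow> z \<in> space S \<Longrightarrow> \<bar>g t z\<bar> \<le> D * \<bar>\<Sum>j\<in>J. b t j * \<psi> j z\<bar>"
      "\<And>s t z. s \<in> T \<Longrightarrow> t \<in> T \<Longrightarrow> z \<in> space S \<Longrightarrow>
        \<bar>g s z - g t z\<bar> \<le> D * \<bar>(\<Sum>j\<in>J. b s j * \<psi> j z) - (\<Sum>j\<in>J. b t j * \<psi> j z)\<bar>"
    and r: "r > 0"
  shows "prob {\<omega> \<in> space M. \<exists>t\<in>T. r < (\<Sum>i\<in>I. expectation (\<lambda>\<omega>. g t (Z i \<omega>)) - g t (Z i \<omega>))}
    \<le> 2 * real (card J) * exp (- r\<^sup>2 / (8 * real (card I) * (D * B * K)\<^sup>2))"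
    (is "prob ?E \<le> _")
proof (cases "T = {}")
  case False
  \<comment> \<open>minimizes \<open>2 (l D B K)\<^sup>2 |I| - l r\<close>\<close>
  define l where "l = r / (4 * real (card I) * (D * B * K)\<^sup>2)"
  have cardI: "real (card I) > 0" using I by (simp add: card_gt_0_iff)
  have l: "l > 0"
    unfolding l_def using r cardI K(2) b(2) D by (intro divide_pos_pos mult_pos_pos) auto
  have Z [measurable]: "Z i \<in> measurable M S" if "i \<in> I" for i
    using indep that by (auto simp: indep_vars_def)
  obtain i0 where i0: "i0 \<in> I" using I by auto
  \<comment> \<open>Indices outside \<open>I\<close> borrow the law of \<open>i0\<close>, so that
    every factor is a probability measure.\<close>
  define \<mu> where "\<mu> i = distr M S (Z (if i \<in> I then i else i0))" for i
  have \<mu>: "prob_space (\<mu> i)" "sets (\<mu> i) = sets S" for i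
    unfolding \<mu>_def using i0 by (auto intro!: prob_space_distr Z)
  have PiM: "distr M (\<Pi>\<^sub>M i\<in>I. S) (\<lambda>\<omega>. \<lambda>i\<in>I. Z i \<omega>) = PiM I \<mu>"
    using indep_vars_iff_distr_eq_PiM'[of I Z "\<lambda>_. S"] I Z indep
    by (auto simp: \<mu>_def cong: PiM_cong)
  have [measurable]: "g t \<in> borel_measurable S" if "t \<in> T" for t
    using meas that by auto
  have int: "(\<integral>z. g t z \<partial>\<mu> i) = expectation (\<lambda>\<omega>. g t (Z i \<omega>))" if "t \<in> T" "i \<in> I" for t i
    using that by (simp add: \<mu>_def integral_distr)
  define W where "W t \<omega> = (\<Sum>i\<in>I. expectation (\<lambda>\<omega>. g t (Z i \<omega>)) - g t (Z i \<omega>))" for t \<omega>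
  have [measurable]: "W t \<in> borel_measurable M" if "t \<in> T" for t
    unfolding W_def using that by measurable
  have E: "?E = {\<omega> \<in> space M. \<exists>t\<in>T. r < W t \<omega>}"
    by (simp add: W_def)
  have E_meas: "?E \<in> events"
    unfolding E using T by measurable
  have "emeasure M ?E = (\<integral>\<^sup>+\<omega>. indicator ?E \<omega> \<partial>M)"
    using E_meas by simp
  also have "\<dots> \<le> (\<integral>\<^sup>+\<omega>. ennreal (exp (- l * r)) * ennreal (exp (MAX t\<in>T. l * W t \<omega>)) \<partial>M)"
  proof (rule nn_integral_mono)
    fix \<omega>
    show "indicator ?E \<omega> \<le> ennreal (exp (- l * r)) * ennreal (exp (MAX t\<in>T. l * W t \<omega>))"
    proof (cases "\<omega> \<in> ?E")
      case True
      then obtain t where t: "t \<in> T" "r < W t \<omega>" unfolding E by auto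
      then have "l * r \<le> l * W t \<omega>" using l by simp
      also have "\<dots> \<le> (MAX t\<in>T. l * W t \<omega>)" using t(1) T by (intro Max_ge) auto
      finally have "1 \<le> exp (- l * r) * exp (MAX t\<in>T. l * W t \<omega>)"
        unfolding exp_add[symmetric] by simp
      then show ?thesis
        using True by (simp flip: ennreal_mult' ennreal_1)
    qed simp
  qed
  also have "\<dots> = ennreal (exp (- l * r)) * (\<integral>\<^sup>+\<omega>. ennreal (exp (MAX t\<in>T. l * W t \<omega>)) \<partial>M)"
    using T False by (intro nn_integral_cmult) measurable
  also have "(\<integral>\<^sup>+\<omega>. ennreal (exp (MAX t\<in>T. l * W t \<omega>)) \<partial>M)
    = (\<integral>\<^sup>+\<omega>. exp (MAX t\<in>T. \<Sum>i\<in>I. (\<integral>z. l * g t z \<partial>\<mu> i) - l * g t ((\<lambda>i\<in>I. Z i \<omega>) i)) \<partial>M)"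
    by (intro nn_integral_cong arg_cong[where f = "\<lambda>x. ennreal (exp x)"] arg_cong[where f = Max] image_cong)
       (simp_all add: W_def int sum_distrib_left right_diff_distrib)
  also have "\<dots> = (\<integral>\<^sup>+z. exp (MAX t\<in>T. \<Sum>i\<in>I. (\<integral>z. l * g t z \<partial>\<mu> i) - l * g t (z i)) \<partial>PiM I \<mu>)"
    unfolding PiM[symmetric] using T False
    by (subst nn_integral_distr) (auto intro!: measurable_restrict)
  also have "\<dots> = (\<integral>\<^sup>+z. exp (MAX t\<in>T. (\<Sum>j\<in>J. l * D * b t j * 0) +
      (\<Sum>i\<in>I. (\<integral>z. l * g t z \<partial>\<mu> i) - l * g t (z i))) \<partial>PiM I \<mu>)"
    by simp
  also have "\<dots> \<le> (\<Sum>j\<in>J. 2 * cosh ((l * D * B) * 0)) * exp (2 * ((l * D * B) * K)\<^sup>2) ^ card I"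
  proof (rule nn_integral_exp_Max_PiM_le[OF \<mu> I(1) T False J _ meas(2) K(1)])
    fix t assume "t \<in> T"
    then have "l * D * (\<Sum>j\<in>J. \<bar>b t j\<bar>) \<le> l * D * B"
      using b l D by (intro mult_left_mono) auto
    then show "(\<Sum>j\<in>J. \<bar>l * D * b t j\<bar>) \<le> l * D * B"
      using l D by (simp add: abs_mult sum_distrib_left)
  next
    have *: "(\<Sum>j\<in>J. l * D * b t j * \<psi> j z) = l * D * (\<Sum>j\<in>J. b t j * \<psi> j z)" for t z
      by (simp add: sum_distrib_left mult_ac)
    show "\<bar>l * g t z\<bar> \<le> \<bar>\<Sum>j\<in>J. l * D * b t j * \<psi> j z\<bar>" if "t \<in> T" "z \<in> space S" for t z
      using mult_left_mono[OF g(1)[OF that], of l] l D unfolding * by (simp add: abs_mult)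
    show "\<bar>l * g s z - l * g t z\<bar>
        \<le> \<bar>(\<Sum>j\<in>J. l * D * b s j * \<psi> j z) - (\<Sum>j\<in>J. l * D * b t j * \<psi> j z)\<bar>"
      if "s \<in> T" "t \<in> T" "z \<in> space S" for s t z
      using mult_left_mono[OF g(2)[OF that], of l] l D unfolding * right_diff_distrib[symmetric]
      by (simp add: abs_mult)
  qed auto
  also have "ennreal (exp (- l * r)) * ennreal ((\<Sum>j\<in>J. 2 * cosh ((l * D * B) * 0)) * exp (2 * ((l * D * B) * K)\<^sup>2) ^ card I)
    = ennreal (2 * real (card J) * exp (- r\<^sup>2 / (8 * real (card I) * (D * B * K)\<^sup>2)))"
  proof -
    have "2 * ((l * D * B) * K)\<^sup>2 * real (card I) - l * r = - r\<^sup>2 / (8 * real (card I) * (D * B * K)\<^sup>2)"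
      unfolding l_def using cardI K(2) b(2) D by (simp add: field_simps power2_eq_square)
    then have "exp (- l * r) * exp (2 * ((l * D * B) * K)\<^sup>2) ^ card I
        = exp (- r\<^sup>2 / (8 * real (card I) * (D * B * K)\<^sup>2))"
      by (simp add: mult.commute flip: exp_of_nat_mult exp_add)
    then show ?thesis
      by (simp add: mult_ac flip: ennreal_mult')
  qed
  finally show ?thesis
    by (simp add: emeasure_eq_measure mult_left_mono)
qed simp

text \<open>Continuity from below along an enumeration of \<open>T\<close>: the events for its
  initial segments increase to the whole event, so a bound uniform over finite subsets
  survives.\<close>

lemma (in prob_space) prob_ex_countable_le:
  assumes T: "countable T" and P: "\<And>t. t \<in> T \<Longrightarrow> {\<omega> \<in> space M. P t \<omega>} \<in> events"
    and le: "\<And>T'. finite T' \<Longrightarrow> T' \<subseteq> T \<Longrightarrow> prob {\<omega> \<in> space M. \<exists>t\<in>T'. P t \<omega>} \<le> q"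
  shows "{\<omega> \<in> space M. \<exists>t\<in>T. P t \<omega>} \<in> events" "prob {\<omega> \<in> space M. \<exists>t\<in>T. P t \<omega>} \<le> q"
proof -
  show ev: "{\<omega> \<in> space M. \<exists>t\<in>T. P t \<omega>} \<in> events"
    by (intro sets.sets_Collect_countable_Ex' P T)
  show "prob {\<omega> \<in> space M. \<exists>t\<in>T. P t \<omega>} \<le> q"
  proof (cases "T = {}")
    case True
    then show ?thesis using le[of "{}"] by simp
  next
    case False
    define E where "E k = {\<omega> \<in> space M. \<exists>t\<in>from_nat_into T ` {..k}. P t \<omega>}" for k
    have "incseq E"
      unfolding E_def incseq_def by (auto intro: order_trans)
    moreover have "range E \<subseteq> events"
      unfolding E_def using from_nat_into[OF False] P
      by (auto intro!: sets.sets_Collect_finite_Ex)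
    ultimately have "(\<lambda>k. prob (E k)) \<longlonglongrightarrow> prob (\<Union>k. E k)"
      by (intro finite_Lim_measure_incseq)
    moreover have "(\<Union>k. E k) = {\<omega> \<in> space M. \<exists>t\<in>T. P t \<omega>}"
      unfolding E_def using range_from_nat_into[OF False T] by blast
    moreover have "prob (E k) \<le> q" for k
      unfolding E_def using from_nat_into[OF False] by (intro le) auto
    ultimately show ?thesis
      by (auto intro: LIMSEQ_le_const2)
  qed
qed

text \<open>Continuity from above for the tail unions, each of which contains some
  \<open>A m\<close>. Intersecting the \<open>A k\<close> instead could lose probability with every
  \<open>k\<close>.\<close>

lemma (in prob_space) prob_limsup_ge:
  fixes A :: "nat \<Rightarrow> 'a set"
  assumes A: "\<And>k. A k \<in> events" and q: "\<And>k. q \<le> prob (A k)"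
  shows "(\<Inter>m. \<Union>k\<in>{m..}. A k) \<in> events" "q \<le> prob (\<Inter>m. \<Union>k\<in>{m..}. A k)"
proof -
  let ?U = "\<lambda>m. \<Union>k\<in>{m..}. A k"
  have U: "?U m \<in> events" for m
    using A by (intro sets.countable_UN') auto
  then show "(\<Inter>m. ?U m) \<in> events"
    by (intro sets.countable_INT) auto
  have "decseq ?U"
    unfolding decseq_def by (auto intro: order_trans)
  then have "(\<lambda>m. prob (?U m)) \<longlonglongrightarrow> prob (\<Inter>m. ?U m)"
    using U by (intro finite_Lim_measure_decseq) auto
  moreover have "q \<le> prob (?U m)" for m
  proof -
    have "q \<le> prob (A m)" by (rule q)
    also have "\<dots> \<le> prob (?U m)"
      using U by (intro finite_measure_mono) auto
    finally show ?thesis .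
  qed
  ultimately show "q \<le> prob (\<Inter>m. ?U m)"
    by (auto intro: LIMSEQ_le_const)
qed

section \<open>Penalties, norms and restricted eigenvalues\<close>

lemma l1_norm_nonneg: "0 \<le> l1_norm p \<beta>"
  by (simp add: l1_norm_def sum_nonneg)

lemma l2_norm_nonneg: "0 \<le> l2_norm p \<beta>"
  by (simp add: l2_norm_def L2_set_nonneg)

lemma l2_norm_square: "(l2_norm p \<beta>)\<^sup>2 = (\<Sum>j=1..p. (\<beta> j)\<^sup>2)"
  unfolding l2_norm_def L2_set_def by (intro real_sqrt_pow2 sum_nonneg) simp

lemma l1_norm_split: "l1_norm p \<beta> = l1_norm p (restr S \<beta>) + l1_norm p (restr (- S) \<beta>)"
  unfolding l1_norm_def sum.distrib[symmetric] by (intro sum.cong) (auto simp: restr_def)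

text \<open>Cauchy-Schwarz against the indicator of \<open>S\<close>.\<close>

lemma l1_norm_restr_le:
  assumes "S \<subseteq> {1..p}"
  shows "l1_norm p (restr S \<beta>) \<le> sqrt (real (card S)) * l2_norm p (restr S \<beta>)"
proof -
  have "l1_norm p (restr S \<beta>) = (\<Sum>j=1..p. \<bar>indicator S j\<bar> * \<bar>restr S \<beta> j\<bar>)"
    unfolding l1_norm_def by (intro sum.cong) (auto simp: restr_def)
  also have "\<dots> \<le> L2_set (indicator S) {1..p} * l2_norm p (restr S \<beta>)"
    unfolding l2_norm_def by (rule L2_set_mult_ineq)
  also have "L2_set (indicator S) {1..p} = sqrt (\<Sum>j=1..p. indicator S j)"
    unfolding L2_set_def by (intro arg_cong[where f = sqrt] sum.cong) (auto simp: indicator_def)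
  also have "(\<Sum>j=1..p. indicator S j :: real) = real (card S)"
    using assms by (simp add: indicator_def sum.If_cases Int_absorb1)
  finally show ?thesis .
qed

lemma l1_norm_convex_comb_le:
  assumes "0 \<le> t" "t \<le> 1"
  shows "l1_norm p (\<lambda>j. t * \<beta> j + (1 - t) * \<beta>' j) \<le> t * l1_norm p \<beta> + (1 - t) * l1_norm p \<beta>'"
proof -
  have "\<bar>t * x + (1 - t) * y\<bar> \<le> t * \<bar>x\<bar> + (1 - t) * \<bar>y\<bar>" for x y :: real
    using abs_triangle_ineq[of "t * x" "(1 - t) * y"] assms by (simp add: abs_mult)
  then show ?thesis
    unfolding l1_norm_def sum_distrib_left sum.distrib[symmetric] by (intro sum_mono)
qed

lemma l2_norm_square_convex_comb_le:
  assumes "0 \<le> t" "t \<le> 1"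
  shows "(l2_norm p (\<lambda>j. t * \<beta> j + (1 - t) * \<beta>' j))\<^sup>2 \<le> t * (l2_norm p \<beta>)\<^sup>2 + (1 - t) * (l2_norm p \<beta>')\<^sup>2"
proof -
  have "(t * x + (1 - t) * y)\<^sup>2 \<le> t * x\<^sup>2 + (1 - t) * y\<^sup>2" for x y :: real
  proof -
    have "t * x\<^sup>2 + (1 - t) * y\<^sup>2 - (t * x + (1 - t) * y)\<^sup>2 = t * (1 - t) * (x - y)\<^sup>2"
      by (simp add: power2_eq_square algebra_simps)
    also have "\<dots> \<ge> 0" using assms by simp
    finally show ?thesis by simp
  qed
  then show ?thesis
    unfolding l2_norm_square sum_distrib_left sum.distrib[symmetric] by (intro sum_mono)
qed

text \<open>All terms are compared coordinatewise. Off the support of \<open>b\<close> the deviation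
  is \<open>\<beta>\<close> itself, so its absolute value enters with a favourable sign; on the
  support the triangle inequality applies. The squares are expanded at \<open>b\<close> and the
  cross term is bounded by Cauchy-Schwarz. The negative square on the support is kept: it becomes
  the \<open>lam2\<close> term of the oracle inequality.\<close>

lemma elastic_net_penalty_diff_le:
  fixes p :: nat and \<beta> b :: "nat \<Rightarrow> real"
  assumes lam: "0 \<le> lam1" "0 \<le> lam2"
  defines "S \<equiv> vsupp p b" and "\<delta> \<equiv> \<lambda>j. \<beta> j - b j"
  shows "lam1 * l1_norm p b + lam2 * (l2_norm p b)\<^sup>2 - (lam1 * l1_norm p \<beta> + lam2 * (l2_norm p \<beta>)\<^sup>2)
    \<le> lam1 * l1_norm p (restr S \<delta>) - lam1 * l1_norm p (restr (- S) \<delta>)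
      + 2 * lam2 * l2_norm p b * l2_norm p (restr S \<delta>) - lam2 * (l2_norm p (restr S \<delta>))\<^sup>2"
proof -
  have "l1_norm p b - l1_norm p \<beta> \<le> l1_norm p (restr S \<delta>) - l1_norm p (restr (- S) \<delta>)"
    unfolding l1_norm_def sum_subtractf[symmetric]
    by (intro sum_mono) (auto simp: restr_def \<delta>_def S_def vsupp_def)
  then have 1: "lam1 * (l1_norm p b - l1_norm p \<beta>)
      \<le> lam1 * (l1_norm p (restr S \<delta>) - l1_norm p (restr (- S) \<delta>))"
    using lam by (intro mult_left_mono)
  have "(l2_norm p b)\<^sup>2 - (l2_norm p \<beta>)\<^sup>2
      \<le> (\<Sum>j=1..p. 2 * (\<bar>b j\<bar> * \<bar>restr S \<delta> j\<bar>) - (restr S \<delta> j)\<^sup>2)"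
    unfolding l2_norm_square sum_subtractf[symmetric]
  proof (rule sum_mono)
    fix j assume j: "j \<in> {1..p}"
    show "(b j)\<^sup>2 - (\<beta> j)\<^sup>2 \<le> 2 * (\<bar>b j\<bar> * \<bar>restr S \<delta> j\<bar>) - (restr S \<delta> j)\<^sup>2"
    proof (cases "j \<in> S")
      case True
      have "(b j)\<^sup>2 - (\<beta> j)\<^sup>2 = - 2 * (b j * \<delta> j) - (\<delta> j)\<^sup>2"
        by (simp add: \<delta>_def power2_eq_square algebra_simps)
      also have "- 2 * (b j * \<delta> j) \<le> 2 * (\<bar>b j\<bar> * \<bar>\<delta> j\<bar>)"
        using abs_ge_minus_self[of "b j * \<delta> j"] unfolding abs_mult by linarith
      finally show ?thesis using True by (simp add: restr_def)
    next
      case False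
      then show ?thesis using j by (simp add: restr_def S_def vsupp_def)
    qed
  qed
  also have "\<dots> = 2 * (\<Sum>j=1..p. \<bar>b j\<bar> * \<bar>restr S \<delta> j\<bar>) - (l2_norm p (restr S \<delta>))\<^sup>2"
    by (simp add: sum_subtractf sum_distrib_left l2_norm_square)
  also have "(\<Sum>j=1..p. \<bar>b j\<bar> * \<bar>restr S \<delta> j\<bar>) \<le> l2_norm p b * l2_norm p (restr S \<delta>)"
    unfolding l2_norm_def by (rule L2_set_mult_ineq)
  finally have "(l2_norm p b)\<^sup>2 - (l2_norm p \<beta>)\<^sup>2
      \<le> 2 * (l2_norm p b * l2_norm p (restr S \<delta>)) - (l2_norm p (restr S \<delta>))\<^sup>2"
    by simp
  then have 2: "lam2 * ((l2_norm p b)\<^sup>2 - (l2_norm p \<beta>)\<^sup>2)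
      \<le> lam2 * (2 * (l2_norm p b * l2_norm p (restr S \<delta>)) - (l2_norm p (restr S \<delta>))\<^sup>2)"
    using lam by (intro mult_left_mono)
  show ?thesis using 1 2 by (simp add: algebra_simps)
qed

section \<open>Function spaces, norms, conjugates and the restricted eigenvalue\<close>

lemma lin_comb_in_function_space:
  assumes F: "function_space F" and \<psi>: "\<And>j. j \<in> {1..p} \<Longrightarrow> \<psi> j \<in> F"
  shows "lin_comb p \<psi> \<beta> \<in> F"
proof -
  have "(\<lambda>x. \<Sum>j\<in>J. \<beta> j * \<psi> j x) \<in> F" if "finite J" "J \<subseteq> {1..p}" for J
    using that
  proof (induction J)
    case empty
    then show ?case using F by (simp add: function_space_def)
  next
    case (insert j J)
    have "(\<lambda>x. \<beta> j * \<psi> j x) \<in> F" "(\<lambda>x. \<Sum>j\<in>J. \<beta> j * \<psi> j x) \<in> F"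
      using insert F \<psi>[of j] by (auto simp: function_space_def)
    then have "(\<lambda>x. \<beta> j * \<psi> j x + (\<Sum>j\<in>J. \<beta> j * \<psi> j x)) \<in> F"
      using F by (auto simp: function_space_def)
    then show ?case using insert.hyps by simp
  qed
  then show ?thesis by (simp add: lin_comb_def)
qed

lemma function_space_diff:
  assumes F: "function_space F" and fg: "f \<in> F" "g \<in> F"
  shows "(\<lambda>x. f x - g x) \<in> F"
proof -
  have add: "(\<lambda>x. f x + h x) \<in> F" if "h \<in> F" for h
    using F fg(1) that by (simp add: function_space_def)
  have "(\<lambda>x. - 1 * g x) \<in> F"
    using F fg(2) unfolding function_space_def by blast
  from add[OF this] show ?thesis by simp
qed

text \<open>The margin condition controls distances to the target only; with the target as
  \<open>h\<close>, two other functions are compared through it.\<close>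

lemma norm_on_triangle_center:
  assumes F: "function_space F" and N: "is_norm_on F N" and fgh: "f \<in> F" "g \<in> F" "h \<in> F"
  shows "N (\<lambda>x. f x - g x) \<le> N (\<lambda>x. f x - h x) + N (\<lambda>x. g x - h x)"
proof -
  have "\<forall>a. \<forall>f\<in>F. N (\<lambda>x. a * f x) = \<bar>a\<bar> * N f"
    using N by (simp add: is_norm_on_def)
  from this[rule_format, OF function_space_diff[OF F fgh(2,3)], of "- 1"]
  have "N (\<lambda>x. h x - g x) = N (\<lambda>x. g x - h x)"
    by simp
  moreover have "\<forall>f\<in>F. \<forall>g\<in>F. N (\<lambda>x. f x + g x) \<le> N f + N g"
    using N by (simp add: is_norm_on_def)
  from this[rule_format, OF function_space_diff[OF F fgh(1,3)] function_space_diff[OF F fgh(3,2)]]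
  have "N (\<lambda>x. f x - g x) \<le> N (\<lambda>x. f x - h x) + N (\<lambda>x. h x - g x)"
    by simp
  ultimately show ?thesis by simp
qed

lemma convex_conjugate_ge:
  assumes "0 \<le> u"
  shows "ereal (u * v - G u) \<le> convex_conjugate G (ereal v)"
  unfolding convex_conjugate_def
  by (rule SUP_upper2[of u]) (use assms in auto)

lemma convex_conjugate_nonneg:
  assumes "G 0 = 0"
  shows "0 \<le> convex_conjugate G v"
proof -
  \<comment> \<open>Infinite \<open>v\<close> is included, because
    \<open>0 * \<infinity> = 0\<close> in \<open>ereal\<close>.\<close>
  have "ereal 0 * v - ereal (G 0) = 0"
    using assms by (cases v) simp_all
  then show ?thesis
    unfolding convex_conjugate_def by (intro SUP_upper2[of 0]) simp_all
qed

text \<open>\<open>\<delta>\<close> competes in the infimum, the cone hypothesis being the defining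
  constraint multiplied by \<open>lam1\<close>. A competitor makes the infimum finite, so that its
  square root is a real number. An empty support, where the infimum is \<open>\<infinity>\<close>,
  is ruled out by \<open>pos\<close>.\<close>

lemma adaptive_re_cone_le:
  assumes re: "adaptive_re N p \<psi> lam1 lam2 b > 0"
    and lam: "lam1 > 0"
    and \<delta>: "\<delta> \<in> Rvec p"
    and cone: "lam1 * l1_norm p (restr (- vsupp p b) \<delta>)
      \<le> 3 * (lam1 * sqrt (real (card (vsupp p b))) + 2 * lam2 * l2_norm p b) * l2_norm p (restr (vsupp p b) \<delta>)"
    and pos: "l2_norm p (restr (vsupp p b) \<delta>) > 0"
    and N: "0 \<le> N (lin_comb p \<psi> \<delta>)"
  obtains \<phi> where "\<phi> > 0" "adaptive_re N p \<psi> lam1 lam2 b = ereal \<phi>"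
    "\<phi> * l2_norm p (restr (vsupp p b) \<delta>) \<le> N (lin_comb p \<psi> \<delta>)"
proof -
  define S where "S = vsupp p b"
  define L where "L = 3 * (sqrt (real (card S)) + 2 * lam2 * l2_norm p (restr S b) / lam1)"
  let ?C = "{\<beta> \<in> Rvec p. \<beta> \<noteq> (\<lambda>j. 0) \<and> l1_norm p (restr (- S) \<beta>) \<le> L * l2_norm p (restr S \<beta>)}"
  define q where "q = adaptive_re_sq N p \<psi> lam1 lam2 b"
  define x where "x = N (lin_comb p \<psi> \<delta>) / l2_norm p (restr S \<delta>)"
  have q: "q = (INF \<beta> \<in> ?C. ereal ((N (lin_comb p \<psi> \<beta>))\<^sup>2 / (l2_norm p (restr S \<beta>))\<^sup>2))"
    unfolding q_def adaptive_re_sq_def S_def L_def Let_def ..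
  \<comment> \<open>Restricting \<open>b\<close> to its own support changes nothing; this matches
    the constant \<open>L\<close> with that of the cone hypothesis.\<close>
  have "l2_norm p (restr S b) = l2_norm p b"
    unfolding l2_norm_def by (intro L2_set_cong) (auto simp: restr_def S_def vsupp_def)
  then have "l1_norm p (restr (- S) \<delta>) \<le> L * l2_norm p (restr S \<delta>)"
    using cone lam by (simp add: L_def S_def field_simps)
  moreover have "\<delta> \<noteq> (\<lambda>j. 0)"
    using pos by (auto simp: restr_def l2_norm_def L2_set_def)
  ultimately have "\<delta> \<in> ?C" using \<delta> by simp
  then have "q \<le> ereal (x\<^sup>2)"
    unfolding q x_def power_divide by (rule INF_lower)
  moreover have "0 \<le> q"
    unfolding q by (intro INF_greatest) simp
  ultimately obtain r where r: "q = ereal r" "0 \<le> r" "r \<le> x\<^sup>2"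
    by (cases q) auto
  then have re_eq: "adaptive_re N p \<psi> lam1 lam2 b = ereal (sqrt r)"
    by (simp add: adaptive_re_def Let_def flip: q_def)
  moreover have "0 \<le> x" using N pos by (simp add: x_def S_def)
  then have "sqrt r \<le> x"
    using r real_le_lsqrt by blast
  then have "sqrt r * l2_norm p (restr S \<delta>) \<le> N (lin_comb p \<psi> \<delta>)"
    using pos by (simp add: x_def S_def field_simps)
  ultimately show ?thesis
    using re by (intro that[of "sqrt r"]) (auto simp: S_def)
qed

text \<open>In \<open>x\<close>, \<open>y\<close> and \<open>w\<close> everything is linear. If
  \<open>2 * x + 4 * y \<le> \<Delta> + \<Xi>s\<close>, the basic inequality suffices because
  \<open>\<Xi>s \<le> \<Delta>\<close>. Otherwise it yields the cone condition, and
  \<open>re\<close> bounds \<open>2 * x + 2 * y\<close> by half of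
  \<open>\<Xi> + \<Xi>s + 2 * H\<close>. Then \<open>\<Xi> / 2\<close> is absorbed on the left, the
  rest is at most \<open>2 * \<Delta>\<close>, and doubling gives \<open>4 * \<Delta>\<close>. This
  accounts for the weights \<open>3\<close> and \<open>2\<close> in the budget.\<close>

lemma oracle_inequality_arith:
  fixes \<Xi> \<Xi>s \<Delta> H lam1 lam2 s a1 a2 b c :: real
  assumes basic: "\<Xi> + lam1 * a2 + lam2 * c\<^sup>2 \<le> \<Delta> + \<Xi>s + lam1 * a1 + 2 * lam2 * b * c"
    and \<Delta>: "3 * \<Xi>s + 2 * H \<le> 2 * \<Delta>" 
    and nonneg: "0 \<le> H" "0 \<le> \<Xi>s" "0 \<le> \<Xi>" "0 \<le> lam1" "0 \<le> lam2" "0 \<le> b" "0 \<le> c"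
    and a: "0 \<le> a1" "0 \<le> a2" and a1: "a1 \<le> s * c"
    and re: "lam1 * a2 \<le> 3 * (lam1 * s + 2 * lam2 * b) * c \<Longrightarrow> 0 < c \<Longrightarrow>
      (4 * lam1 * s + 4 * lam2 * b) * c \<le> \<Xi> + \<Xi>s + 2 * H"
  shows "\<Xi> + lam1 * (a1 + a2) + lam2 * c\<^sup>2 \<le> 4 * \<Delta>"
proof -
  define x y w where "x = lam1 * s * c" and "y = lam2 * b * c" and "w = lam2 * c\<^sup>2"
  have xyw: "lam1 * a1 \<le> x" "0 \<le> y" "0 \<le> w"
    using mult_left_mono[OF a1, of lam1] nonneg by (simp_all add: x_def y_def w_def mult_ac)
  have basic': "\<Xi> + lam1 * a2 + w \<le> \<Delta> + \<Xi>s + lam1 * a1 + 2 * y"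
    using basic by (simp add: y_def w_def mult_ac)
  have "\<Xi> + lam1 * a1 + lam1 * a2 + w \<le> 4 * \<Delta>"
  proof (cases "2 * x + 4 * y \<le> \<Delta> + \<Xi>s")
    case True
    then show ?thesis
      using basic' xyw \<Delta> nonneg by linarith
  next
    case False
    have "lam1 * a2 \<le> 3 * x + 6 * y"
      using False basic' xyw nonneg by linarith
    then have "lam1 * a2 \<le> 3 * (lam1 * s + 2 * lam2 * b) * c"
      by (simp add: x_def y_def algebra_simps)
    \<comment> \<open>At \<open>c = 0\<close> both \<open>x\<close> and \<open>y\<close> vanish and
      the first case would hold.\<close>
    moreover have "c \<noteq> 0"
      using False \<Delta> nonneg by (auto simp: x_def y_def)
    ultimately have "(4 * lam1 * s + 4 * lam2 * b) * c \<le> \<Xi> + \<Xi>s + 2 * H"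
      using nonneg re by simp
    then have "4 * x + 4 * y \<le> \<Xi> + \<Xi>s + 2 * H"
      by (simp add: x_def y_def algebra_simps)
    moreover have "0 \<le> lam1 * a1" "0 \<le> lam1 * a2"
      using a nonneg by simp_all
    ultimately show ?thesis
      using basic' xyw \<Delta> nonneg by linarith
  qed
  then show ?thesis by (simp add: w_def algebra_simps)
qed

section \<open>Linear combinations of the dictionary\<close>

lemma lin_comb_diff: "lin_comb p \<psi> \<beta> x - lin_comb p \<psi> \<beta>' x = lin_comb p \<psi> (\<lambda>j. \<beta> j - \<beta>' j) x"
  by (simp add: lin_comb_def left_diff_distrib sum_subtractf)

lemma abs_lin_comb_le:
  assumes "\<And>j. j \<in> {1..p} \<Longrightarrow> \<bar>\<psi> j x\<bar> \<le> K"
  shows "\<bar>lin_comb p \<psi> \<beta> x\<bar> \<le> K * l1_norm p \<beta>"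
proof -
  have "\<bar>lin_comb p \<psi> \<beta> x\<bar> \<le> (\<Sum>j=1..p. K * \<bar>\<beta> j\<bar>)"
    unfolding lin_comb_def
    using assms by (intro order_trans[OF sum_abs] sum_mono) (simp add: abs_mult mult.commute[of K] mult_left_mono)
  then show ?thesis by (simp add: l1_norm_def sum_distrib_left)
qed

lemma sup_norm_le_iff: "sup_norm f \<le> ereal K \<longleftrightarrow> (\<forall>x. \<bar>f x\<bar> \<le> K)"
  by (simp add: sup_norm_def SUP_le_iff)

section \<open>The elastic net\<close>

context elastic_net
begin

lemma lin_comb_in_F: "lin_comb p \<psi> \<beta> \<in> F"
  by (rule lin_comb_in_function_space[OF function_space dict])

lemma sample_measurable [measurable]:
  "i \<in> {1..n} \<Longrightarrow> Z i \<in> measurable M (MX \<Otimes>\<^sub>M restrict_space borel Y)"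
  using indep_sample by (auto simp: indep_vars_def)

lemma space_sample: "space (MX \<Otimes>\<^sub>M restrict_space borel Y) = UNIV \<times> Y"
  by (simp add: space_pair_measure space_MX space_restrict_space)

lemma sample_in: "\<omega> \<in> space M \<Longrightarrow> i \<in> {1..n} \<Longrightarrow> Z i \<omega> \<in> UNIV \<times> Y"
  using measurable_space[OF sample_measurable] by (simp add: space_sample)

lemma excess_risk_eq:
  assumes "f \<in> F"
  shows "excess_risk M n Z \<rho> f0 f = Pmean M n Z (\<rho> f) - Pmean M n Z (\<rho> f0)"
proof -
  have "f0 \<in> F" using target by (simp add: is_arg_min_def)
  then have "(\<Sum>i=1..n. expectation (\<lambda>\<omega>. \<rho> f (Z i \<omega>) - \<rho> f0 (Z i \<omega>)))
    = (\<Sum>i=1..n. expectation (\<lambda>\<omega>. \<rho> f (Z i \<omega>)) - expectation (\<lambda>\<omega>. \<rho> f0 (Z i \<omega>)))"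
    using assms by (intro sum.cong refl Bochner_Integration.integral_diff loss_integrable)
  then show ?thesis
    unfolding excess_risk_def Pmean_def sum_subtractf diff_divide_distrib[symmetric] by (rule arg_cong)
qed

lemma excess_risk_nonneg:
  assumes "f \<in> F"
  shows "0 \<le> excess_risk M n Z \<rho> f0 f"
  using target assms unfolding excess_risk_eq[OF assms] is_arg_min_linorder by simp

text \<open>A zero excess makes \<open>f\<close> a second minimizer. This identifies the oracle with
  the target when its bound is zero.\<close>

lemma excess_risk_zero_imp:
  assumes "f \<in> F" "excess_risk M n Z \<rho> f0 f = 0"
  shows "f = f0"
  using target assms(1) assms(2)[unfolded excess_risk_eq[OF assms(1)]]
  by (intro target_unique) (simp add: is_arg_min_def)

text \<open>The penalized empirical risk is convex on the segment, and at the end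
  \<open>\<beta>hat \<omega>\<close> it does not exceed its value at \<open>b\<close>. Intermediate
  points matter because the deviation bound holds only in a ball around \<open>b\<close>, which is
  not yet known to contain the estimator.\<close>

lemma estimator_segment:
  assumes \<omega>: "\<omega> \<in> space M" and b: "b \<in> \<Phi>" and t: "0 \<le> t" "t \<le> 1"
  defines "\<beta> \<equiv> \<lambda>j. t * \<beta>hat \<omega> j + (1 - t) * b j"
  shows "\<beta> \<in> \<Phi>"
    "Pn n Z \<omega> (\<rho> (lin_comb p \<psi> \<beta>)) + lam1 * l1_norm p \<beta> + lam2 * (l2_norm p \<beta>)\<^sup>2
      \<le> Pn n Z \<omega> (\<rho> (lin_comb p \<psi> b)) + lam1 * l1_norm p b + lam2 * (l2_norm p b)\<^sup>2"
proof -
  let ?R = "\<lambda>\<beta>. Pn n Z \<omega> (\<rho> (lin_comb p \<psi> \<beta>))"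
  let ?Q = "\<lambda>\<beta>. ?R \<beta> + lam1 * l1_norm p \<beta> + lam2 * (l2_norm p \<beta>)\<^sup>2"
  have hat: "\<beta>hat \<omega> \<in> \<Phi>" "?Q (\<beta>hat \<omega>) \<le> ?Q b"
    using estimator[OF \<omega>] b unfolding is_arg_min_linorder by blast+
  show "\<beta> \<in> \<Phi>"
    using params(2) hat(1) b t unfolding \<beta>_def convex_vecs_def by auto
  have eq: "lin_comb p \<psi> \<beta> = (\<lambda>x. t * lin_comb p \<psi> (\<beta>hat \<omega>) x + (1 - t) * lin_comb p \<psi> b x)"
    unfolding \<beta>_def lin_comb_def sum_distrib_left sum.distrib[symmetric]
    by (intro ext sum.cong) (simp_all add: algebra_simps)
  have convex: "\<rho> (lin_comb p \<psi> \<beta>) z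
      \<le> t * \<rho> (lin_comb p \<psi> (\<beta>hat \<omega>)) z + (1 - t) * \<rho> (lin_comb p \<psi> b) z" if "z \<in> UNIV \<times> Y" for z
    unfolding eq using t by (intro loss_convex lin_comb_in_F that) simp
  have "(\<Sum>i=1..n. \<rho> (lin_comb p \<psi> \<beta>) (Z i \<omega>))
      \<le> (\<Sum>i=1..n. t * \<rho> (lin_comb p \<psi> (\<beta>hat \<omega>)) (Z i \<omega>) + (1 - t) * \<rho> (lin_comb p \<psi> b) (Z i \<omega>))"
    by (intro sum_mono convex sample_in[OF \<omega>])
  then have "?R \<beta> \<le> (\<Sum>i=1..n. t * \<rho> (lin_comb p \<psi> (\<beta>hat \<omega>)) (Z i \<omega>)
      + (1 - t) * \<rho> (lin_comb p \<psi> b) (Z i \<omega>)) / real n"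
    unfolding Pn_def by (rule divide_right_mono) simp
  also have "\<dots> = t * ?R (\<beta>hat \<omega>) + (1 - t) * ?R b"
    by (simp add: Pn_def sum.distrib add_divide_distrib flip: sum_distrib_left)
  finally have R: "?R \<beta> \<le> t * ?R (\<beta>hat \<omega>) + (1 - t) * ?R b" .
  have "?Q \<beta> \<le> (t * ?R (\<beta>hat \<omega>) + (1 - t) * ?R b)
      + lam1 * (t * l1_norm p (\<beta>hat \<omega>) + (1 - t) * l1_norm p b)
      + lam2 * (t * (l2_norm p (\<beta>hat \<omega>))\<^sup>2 + (1 - t) * (l2_norm p b)\<^sup>2)"
    using R l1_norm_convex_comb_le[OF t, of p "\<beta>hat \<omega>" b]
      l2_norm_square_convex_comb_le[OF t, of p "\<beta>hat \<omega>" b] tuning_pos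
    unfolding \<beta>_def[symmetric] by (intro add_mono mult_left_mono) simp_all
  also have "\<dots> = ?Q b - t * (?Q b - ?Q (\<beta>hat \<omega>))"
    by (simp add: algebra_simps)
  also have "\<dots> \<le> ?Q b"
    using hat(2) t by simp
  finally show "?Q \<beta> \<le> ?Q b" .
qed

text \<open>The restricted eigenvalue bounds the left side by \<open>a / \<phi>\<close> times
  \<open>N (lin_comb p \<psi> \<delta>)\<close>, and the triangle inequality through the target
  bounds that by \<open>a / \<phi>\<close> times \<open>u1 + u2\<close>. Young's inequality is used
  once for each of the two distances, whence \<open>2 * H\<close>; the margin bounds then turn
  \<open>G u1\<close> and \<open>G u2\<close> into \<open>e1\<close> and \<open>e2\<close>.\<close>

lemma conj_penalty_re_le:
  assumes H: "conj_penalty N G p \<psi> lam1 lam2 b = ereal H"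
    and re: "adaptive_re N p \<psi> lam1 lam2 b > 0"
    and \<beta>: "\<beta> \<in> Rvec p" "b \<in> Rvec p"
    and margin: "G (N (\<lambda>x. lin_comb p \<psi> \<beta> x - f0 x)) \<le> e1" "G (N (\<lambda>x. lin_comb p \<psi> b x - f0 x)) \<le> e2"
  defines "S \<equiv> vsupp p b" and "\<delta> \<equiv> \<lambda>j. \<beta> j - b j"
  assumes cone: "lam1 * l1_norm p (restr (- S) \<delta>)
      \<le> 3 * (lam1 * sqrt (real (card S)) + 2 * lam2 * l2_norm p b) * l2_norm p (restr S \<delta>)"
    and pos: "0 < l2_norm p (restr S \<delta>)"
  shows "(4 * lam1 * sqrt (real (card S)) + 4 * lam2 * l2_norm p b) * l2_norm p (restr S \<delta>) \<le> e1 + e2 + 2 * H"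
proof -
  have f0: "f0 \<in> F" using target by (simp add: is_arg_min_def)
  note F = function_space_diff[OF function_space]
  have N_nonneg: "0 \<le> N f" if "f \<in> F" for f
    using norm_on that by (simp add: is_norm_on_def)
  have \<delta>: "\<delta> \<in> Rvec p" using \<beta> by (simp add: \<delta>_def Rvec_def)
  obtain \<phi> where \<phi>: "\<phi> > 0" "adaptive_re N p \<psi> lam1 lam2 b = ereal \<phi>"
      "\<phi> * l2_norm p (restr S \<delta>) \<le> N (lin_comb p \<psi> \<delta>)"
    using adaptive_re_cone_le[OF re tuning_pos(1) \<delta> cone[unfolded S_def] pos[unfolded S_def]
        N_nonneg[OF lin_comb_in_F]] unfolding S_def by blast
  define a where "a = 4 * lam1 * sqrt (real (card S)) + 4 * lam2 * l2_norm p b"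
  define u1 u2 where "u1 = N (\<lambda>x. lin_comb p \<psi> \<beta> x - f0 x)" and "u2 = N (\<lambda>x. lin_comb p \<psi> b x - f0 x)"
  have a: "0 \<le> a" using tuning_pos by (simp add: a_def l2_norm_nonneg)
  have "convex_conjugate G (ereal (a / \<phi>)) = ereal H"
    using H \<phi>(1,2) by (simp add: conj_penalty_def a_def S_def)
  then have young: "u * (a / \<phi>) \<le> G u + H" if "0 \<le> u" for u
    using convex_conjugate_ge[OF that, of "a / \<phi>" G] by simp
  have u: "0 \<le> u1" "0 \<le> u2"
    unfolding u1_def u2_def by (intro N_nonneg F lin_comb_in_F f0)+
  have "lin_comb p \<psi> \<delta> = (\<lambda>x. lin_comb p \<psi> \<beta> x - lin_comb p \<psi> b x)"
    by (simp add: lin_comb_diff \<delta>_def)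
  then have "N (lin_comb p \<psi> \<delta>) \<le> u1 + u2"
    unfolding u1_def u2_def
    using norm_on_triangle_center[OF function_space norm_on lin_comb_in_F lin_comb_in_F f0] by simp
  then have "(a / \<phi>) * (\<phi> * l2_norm p (restr S \<delta>)) \<le> (a / \<phi>) * (u1 + u2)"
    using \<phi> a by (intro mult_left_mono) auto
  also have "\<dots> = u1 * (a / \<phi>) + u2 * (a / \<phi>)"
    by (simp only: distrib_left mult.commute[of _ "a / \<phi>"])
  also have "\<dots> \<le> (G u1 + H) + (G u2 + H)"
    by (intro add_mono young u)
  also have "\<dots> \<le> e1 + e2 + 2 * H"
    using margin by (simp add: u1_def u2_def)
  finally show ?thesis using \<phi>(1) by (simp add: a_def)
qed

text \<open>The radius \<open>B\<close> is free as long as \<open>lam0 * B\<close> covers half of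
  the oracle objective, so a positive radius is available even when that objective is zero. The
  local estimate \<open>seg\<close> is used twice: at a point that lies in the ball by construction,
  to localize the estimator, and then at the estimator itself.\<close>

lemma oracle_inequality_of_deviation:
  assumes \<omega>: "\<omega> \<in> space M" and b: "b \<in> \<Phi>" and B: "0 < B" and lam0: "0 < lam0" "8 * lam0 \<le> lam1"
    and G0: "G 0 = 0"
    and H: "conj_penalty N G p \<psi> lam1 lam2 b = ereal H"
    and re: "adaptive_re N p \<psi> lam1 lam2 b > 0"
    and budget: "3 * excess_risk M n Z \<rho> f0 (lin_comb p \<psi> b) + 2 * H \<le> 2 * (lam0 * B)"
    and margin: "\<And>f. f \<in> F_local F f0 \<eta> \<Longrightarrow> G (N (\<lambda>x. f x - f0 x)) \<le> excess_risk M n Z \<rho> f0 f"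
    and local_b: "lin_comb p \<psi> b \<in> F_local F f0 \<eta>"
    and nearby: "\<And>\<beta>. \<beta> \<in> Rvec p \<Longrightarrow> l1_norm p (\<lambda>j. \<beta> j - b j) \<le> B \<Longrightarrow> lin_comb p \<psi> \<beta> \<in> F_local F f0 \<eta>"
    and dev: "\<And>\<beta>. \<beta> \<in> \<Phi> \<Longrightarrow> l1_norm p (\<lambda>j. \<beta> j - b j) \<le> B \<Longrightarrow>
      (Pmean M n Z (\<rho> (lin_comb p \<psi> \<beta>)) - Pmean M n Z (\<rho> (lin_comb p \<psi> b)))
        - (Pn n Z \<omega> (\<rho> (lin_comb p \<psi> \<beta>)) - Pn n Z \<omega> (\<rho> (lin_comb p \<psi> b))) \<le> lam0 * B"
  shows "excess_risk M n Z \<rho> f0 (lin_comb p \<psi> (\<beta>hat \<omega>)) + lam1 * l1_norm p (\<lambda>j. \<beta>hat \<omega> j - b j)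
    + lam2 * (l2_norm p (\<lambda>j. restr (vsupp p b) (\<beta>hat \<omega>) j - restr (vsupp p b) b j))\<^sup>2 \<le> 4 * (lam0 * B)"
proof -
  define S where "S = vsupp p b"
  define \<Xi> where "\<Xi> \<beta> = excess_risk M n Z \<rho> f0 (lin_comb p \<psi> \<beta>)" for \<beta>
  have \<Xi>_nonneg: "0 \<le> \<Xi> \<beta>" for \<beta>
    by (simp add: \<Xi>_def excess_risk_nonneg lin_comb_in_F)
  have H_nonneg: "0 \<le> H"
    using convex_conjugate_nonneg[of G, OF G0] H[symmetric] by (simp add: conj_penalty_def flip: ereal_less_eq(5))
  have lams: "0 < lam1" "0 < lam2" by (fact tuning_pos)+
  have seg: "\<Xi> \<beta> + lam1 * l1_norm p (\<lambda>j. \<beta> j - b j) + lam2 * (l2_norm p (restr S (\<lambda>j. \<beta> j - b j)))\<^sup>2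
      \<le> 4 * (lam0 * B)"
    if t: "0 \<le> t" "t \<le> 1" and \<beta>: "\<beta> = (\<lambda>j. t * \<beta>hat \<omega> j + (1 - t) * b j)"
      and near: "l1_norm p (\<lambda>j. \<beta> j - b j) \<le> B" for t \<beta>
  proof -
    define \<delta> where "\<delta> = (\<lambda>j. \<beta> j - b j)"
    note seg = estimator_segment[OF \<omega> b t, folded \<beta>]
    have Rvec: "\<beta> \<in> Rvec p" "b \<in> Rvec p" using seg(1) b params(1) by auto
    \<comment> \<open>The basic inequality: the comparison along the segment, the deviation bound
      and the penalty difference added up.\<close>
    have "\<Xi> \<beta> + lam1 * l1_norm p (restr (- S) \<delta>) + lam2 * (l2_norm p (restr S \<delta>))\<^sup>2
      \<le> lam0 * B + \<Xi> b + lam1 * l1_norm p (restr S \<delta>) + 2 * lam2 * l2_norm p b * l2_norm p (restr S \<delta>)"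
      using seg(2) dev[OF seg(1) near] elastic_net_penalty_diff_le[of lam1 lam2 p b \<beta>] lams
      unfolding \<Xi>_def S_def \<delta>_def excess_risk_eq[OF lin_comb_in_F] by linarith
    then have "\<Xi> \<beta> + lam1 * (l1_norm p (restr S \<delta>) + l1_norm p (restr (- S) \<delta>)) + lam2 * (l2_norm p (restr S \<delta>))\<^sup>2
      \<le> 4 * (lam0 * B)"
    proof (rule oracle_inequality_arith[where H = H])
      show "l1_norm p (restr S \<delta>) \<le> sqrt (real (card S)) * l2_norm p (restr S \<delta>)"
        by (rule l1_norm_restr_le) (auto simp: S_def vsupp_def)
      assume "lam1 * l1_norm p (restr (- S) \<delta>)
        \<le> 3 * (lam1 * sqrt (real (card S)) + 2 * lam2 * l2_norm p b) * l2_norm p (restr S \<delta>)"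
        "0 < l2_norm p (restr S \<delta>)"
      then show "(4 * lam1 * sqrt (real (card S)) + 4 * lam2 * l2_norm p b) * l2_norm p (restr S \<delta>)
          \<le> \<Xi> \<beta> + \<Xi> b + 2 * H"
        unfolding S_def \<delta>_def \<Xi>_def
        by (rule conj_penalty_re_le[OF H re Rvec margin[OF nearby[OF Rvec(1) near]] margin[OF local_b]])
    qed (use budget \<Xi>_nonneg H_nonneg lams in \<open>simp_all add: \<Xi>_def l1_norm_nonneg l2_norm_nonneg\<close>)
    then show ?thesis
      unfolding \<delta>_def l1_norm_split[of p "\<lambda>j. \<beta> j - b j" S] .
  qed
  define h where "h = l1_norm p (\<lambda>j. \<beta>hat \<omega> j - b j)"
  have h: "0 \<le> h" by (simp add: h_def l1_norm_nonneg)
  \<comment> \<open>With this weight \<open>t * h \<le> B\<close> for every \<open>h\<close>, while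
    \<open>2 * (t * h) \<le> B\<close> is equivalent to \<open>h \<le> B\<close>.\<close>
  define t where "t = B / (B + h)"
  have t: "0 \<le> t" "t \<le> 1" using B h by (simp_all add: t_def)
  have "l1_norm p (\<lambda>j. t * \<beta>hat \<omega> j + (1 - t) * b j - b j) = l1_norm p (\<lambda>j. t * (\<beta>hat \<omega> j - b j))"
    by (simp add: algebra_simps)
  also have "\<dots> = t * h"
    using t by (simp add: h_def l1_norm_def abs_mult sum_distrib_left)
  finally have th: "l1_norm p (\<lambda>j. t * \<beta>hat \<omega> j + (1 - t) * b j - b j) = t * h" .
  have "t * h \<le> B" using B h by (simp add: t_def field_simps)
  from seg[OF t refl this[folded th]] have "lam1 * (t * h) \<le> 4 * (lam0 * B)"
    unfolding th using \<Xi>_nonneg lams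
    by (smt (verit) mult_nonneg_nonneg zero_le_power2)
  \<comment> \<open>The \<open>8\<close> outweighs the constant \<open>4\<close> of the local
    estimate by a factor \<open>2\<close>, which halves the radius.\<close>
  moreover have "8 * lam0 * (t * h) \<le> lam1 * (t * h)"
    using lam0 t h by (intro mult_right_mono) auto
  ultimately have "lam0 * (2 * (t * h)) \<le> lam0 * B" by simp
  then have "2 * (t * h) \<le> B" using lam0 by simp
  then have "h \<le> B" using B h by (simp add: t_def field_simps)
  then have "\<Xi> (\<beta>hat \<omega>) + lam1 * h + lam2 * (l2_norm p (restr S (\<lambda>j. \<beta>hat \<omega> j - b j)))\<^sup>2 \<le> 4 * (lam0 * B)"
    unfolding h_def by (intro seg[of 1]) auto
  moreover have "restr S (\<lambda>j. \<beta>hat \<omega> j - b j) = (\<lambda>j. restr S (\<beta>hat \<omega>) j - restr S b j)"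
    by (auto simp: restr_def)
  ultimately show ?thesis by (simp add: \<Xi>_def h_def S_def)
qed

text \<open>The constants \<open>c f\<close> cancel in the difference of mean and empirical mean, so
  only the Lipschitz part counts. The tail bound at level \<open>r\<close> holds for finite parts of
  a countable dense subset of the ball, then for that subset, and by continuity for the
  ball.\<close>

lemma uniform_deviation_event:
  fixes K D B lam0 :: real
  assumes K: "0 < K" "\<And>j x. j \<in> {1..p} \<Longrightarrow> \<bar>\<psi> j x\<bar> \<le> K"
    and loss: "\<forall>f\<in>F. \<forall>x. \<forall>y\<in>Y. \<rho> f (x, y) = \<gamma> y (f x) + c f"
    and D: "0 < D"
    and lip: "\<forall>x. \<forall>y\<in>Y. \<forall>\<beta>\<in>\<Phi>. \<forall>\<beta>'\<in>\<Phi>.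
       \<bar>\<gamma> y (lin_comb p \<psi> \<beta> x) - \<gamma> y (lin_comb p \<psi> \<beta>' x)\<bar>
         \<le> D * \<bar>lin_comb p \<psi> \<beta> x - lin_comb p \<psi> \<beta>' x\<bar>"
    and p: "2 \<le> p" and n: "0 < n"
    and lam0: "lam0 = 5 * K * D * sqrt (ln (real p) / real n)"
    and b: "b \<in> \<Phi>" and B: "0 < B"
  obtains A where "A \<in> sets M" "1 - 1 / real p \<le> measure M A"
    "\<And>\<omega> \<beta>. \<omega> \<in> A \<Longrightarrow> \<beta> \<in> \<Phi> \<Longrightarrow> l1_norm p (\<lambda>j. \<beta> j - b j) \<le> B \<Longrightarrow>
      (Pmean M n Z (\<rho> (lin_comb p \<psi> \<beta>)) - Pmean M n Z (\<rho> (lin_comb p \<psi> b)))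
        - (Pn n Z \<omega> (\<rho> (lin_comb p \<psi> \<beta>)) - Pn n Z \<omega> (\<rho> (lin_comb p \<psi> b))) \<le> lam0 * B"
proof -
  let ?S = "MX \<Otimes>\<^sub>M restrict_space borel Y" and ?f = "lin_comb p \<psi>"
  define U where "U = {\<beta> \<in> \<Phi>. l1_norm p (\<lambda>j. \<beta> j - b j) \<le> B}"
  \<comment> \<open>Centred at \<open>b\<close> and stripped of the constants, the losses satisfy
    the contraction hypotheses, and their deviations do not change.\<close>
  define g where "g \<beta> z = \<rho> (?f \<beta>) z - \<rho> (?f b) z - (c (?f \<beta>) - c (?f b))" for \<beta> z
  define W where "W \<beta> \<omega> = (\<Sum>i=1..n. expectation (\<lambda>\<omega>. g \<beta> (Z i \<omega>)) - g \<beta> (Z i \<omega>))" for \<beta> \<omega>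
  define r where "r = real n * (lam0 * B)"
  have lam0_pos: "0 < lam0" using K D p n by (simp add: lam0)
  have r: "0 < r" using lam0_pos B n by (simp add: r_def)
  have g_eq: "g \<beta> (x, y) = \<gamma> y (?f \<beta> x) - \<gamma> y (?f b x)" if "y \<in> Y" for \<beta> x y
    using loss that lin_comb_in_F by (simp add: g_def)
  have g_diff: "\<bar>g \<beta> z - g \<beta>' z\<bar> \<le> D * \<bar>?f \<beta> (fst z) - ?f \<beta>' (fst z)\<bar>"
    if "\<beta> \<in> \<Phi>" "\<beta>' \<in> \<Phi>" "z \<in> UNIV \<times> Y" for \<beta> \<beta>' z
    using that lip by (cases z) (auto simp: g_eq)
  have g_b: "g b z = 0" for z by (simp add: g_def)
  have g_meas: "g \<beta> \<in> borel_measurable ?S" for \<beta>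
    unfolding g_def using loss_measurable[OF lin_comb_in_F] by measurable
  have g_int: "integrable M (\<lambda>\<omega>. g \<beta> (Z i \<omega>))" if "i \<in> {1..n}" for \<beta> i
    unfolding g_def using loss_integrable[OF lin_comb_in_F that] by simp
  have g_lip: "\<bar>g \<beta> z - g \<beta>' z\<bar> \<le> D * (K * l1_norm p (\<lambda>j. \<beta> j - \<beta>' j))"
    if "\<beta> \<in> \<Phi>" "\<beta>' \<in> \<Phi>" "z \<in> UNIV \<times> Y" for \<beta> \<beta>' z
    using g_diff[OF that] D abs_lin_comb_le[of p \<psi> "fst z" K "\<lambda>j. \<beta> j - \<beta>' j"] K(2)
    unfolding lin_comb_diff by (meson less_imp_le mult_left_mono order_trans)
  have W_eq: "W \<beta> \<omega> = real n * ((Pmean M n Z (\<rho> (?f \<beta>)) - Pmean M n Z (\<rho> (?f b)))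
      - (Pn n Z \<omega> (\<rho> (?f \<beta>)) - Pn n Z \<omega> (\<rho> (?f b))))" for \<beta> \<omega>
  proof -
    have "expectation (\<lambda>\<omega>. g \<beta> (Z i \<omega>))
      = expectation (\<lambda>\<omega>. \<rho> (?f \<beta>) (Z i \<omega>)) - expectation (\<lambda>\<omega>. \<rho> (?f b) (Z i \<omega>)) - (c (?f \<beta>) - c (?f b))"
      if "i \<in> {1..n}" for i
      unfolding g_def using loss_integrable[OF lin_comb_in_F that] by (simp add: prob_space)
    then have "W \<beta> \<omega> = (\<Sum>i=1..n. (expectation (\<lambda>\<omega>. \<rho> (?f \<beta>) (Z i \<omega>)) - expectation (\<lambda>\<omega>. \<rho> (?f b) (Z i \<omega>)))
        - (\<rho> (?f \<beta>) (Z i \<omega>) - \<rho> (?f b) (Z i \<omega>)))"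
      unfolding W_def by (intro sum.cong) (simp_all add: g_def)
    then show ?thesis
      using n by (simp add: Pmean_def Pn_def sum_subtractf diff_divide_distrib[symmetric])
  qed
  \<comment> \<open>Density refers to coordinatewise convergence, in which \<open>l1_norm p\<close>
    is continuous since it involves finitely many coordinates.\<close>
  obtain T where T: "countable T" "T \<subseteq> U" "U \<subseteq> closure T"
    using separable[of U] by blast
  have ev: "{\<omega> \<in> space M. r < W t \<omega>} \<in> events" for t
  proof -
    have "W t \<in> borel_measurable M"
      unfolding W_def using measurable_compose[OF sample_measurable g_meas] by measurable
    then show ?thesis by measurable
  qed
  have finite_le: "prob {\<omega> \<in> space M. \<exists>t\<in>T'. r < W t \<omega>} \<le> 1 / real p" if T': "finite T'" "T' \<subseteq> T" for T'
  proof -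
    have T'U: "T' \<subseteq> U" using T' T by auto
    have b_coef: "(\<Sum>j\<in>{1..p}. (t j - b j) * \<psi> j (fst z)) = ?f t (fst z) - ?f b (fst z)" for t z
      unfolding lin_comb_diff by (simp add: lin_comb_def)
    have "prob {\<omega> \<in> space M. \<exists>t\<in>T'. r < W t \<omega>}
      \<le> 2 * real (card {1..p}) * exp (- r\<^sup>2 / (8 * real (card {1..n}) * (D * B * K)\<^sup>2))"
      unfolding W_def
    proof (rule prob_deviation_finite_le[where S = ?S and \<psi> = "\<lambda>j z. \<psi> j (fst z)" and b = "\<lambda>t j. t j - b j", OF indep_sample])
      show "(\<lambda>z. \<psi> j (fst z)) \<in> borel_measurable ?S" if "j \<in> {1..p}" for j
        using dict_measurable[OF that] by measurable
      show "\<bar>g t z\<bar> \<le> D * \<bar>\<Sum>j\<in>{1..p}. (t j - b j) * \<psi> j (fst z)\<bar>" if "t \<in> T'" "z \<in> space ?S" for t z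
        using g_diff[of t b z] that T'U b unfolding b_coef space_sample by (auto simp: U_def g_b)
      show "\<bar>g s z - g t z\<bar> \<le> D * \<bar>(\<Sum>j\<in>{1..p}. (s j - b j) * \<psi> j (fst z)) - (\<Sum>j\<in>{1..p}. (t j - b j) * \<psi> j (fst z))\<bar>"
        if "s \<in> T'" "t \<in> T'" "z \<in> space ?S" for s t z
        using g_diff[of s t z] that T'U unfolding b_coef space_sample by (auto simp: U_def)
      show "(\<Sum>j\<in>{1..p}. \<bar>t j - b j\<bar>) \<le> B" if "t \<in> T'" for t
        using that T'U by (auto simp: U_def l1_norm_def)
      show "g t \<in> borel_measurable ?S" if "t \<in> T'" for t by (rule g_meas)
      show "\<bar>\<psi> j (fst z)\<bar> \<le> K" if "j \<in> {1..p}" for j and z :: "'x \<times> real" using K(2)[OF that] .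
    qed (use n p K D B r T' in auto)
    \<comment> \<open>The \<open>5\<close> in \<open>lam0\<close> produces the \<open>25\<close>;
      the sample size, \<open>B\<close>, \<open>D\<close> and \<open>K\<close> cancel.\<close>
    also have "- r\<^sup>2 / (8 * real (card {1..n}) * (D * B * K)\<^sup>2) = - (25 / 8) * ln (real p)"
    proof -
      have "r\<^sup>2 = real n * B\<^sup>2 * (real n * lam0\<^sup>2)"
        by (simp add: r_def power2_eq_square)
      also have "lam0\<^sup>2 = (5 * K * D)\<^sup>2 * (ln (real p) / real n)"
        using p by (simp add: lam0 power_mult_distrib)
      also have "real n * B\<^sup>2 * (real n * ((5 * K * D)\<^sup>2 * (ln (real p) / real n)))
          = real n * (25 * (D * B * K)\<^sup>2 * ln (real p))"
        using n by (simp add: power2_eq_square)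
      finally have "r\<^sup>2 = real n * (25 * (D * B * K)\<^sup>2 * ln (real p))" .
      then show ?thesis using n K D B by simp
    qed
    \<comment> \<open>\<open>25 / 8\<close> is lowered to \<open>3\<close>; the resulting
      \<open>2 / p\<^sup>2\<close> is at most \<open>1 / p\<close> as
      \<open>p \<ge> 2\<close>.\<close>
    also have "2 * real (card {1..p}) * exp (- (25 / 8) * ln (real p)) \<le> 2 * real p * exp (- 3 * ln (real p))"
      using p by simp
    also have "exp (- 3 * ln (real p)) = 1 / real p ^ 3"
    proof -
      have "exp (3 * ln (real p)) = real p ^ 3"
        using p exp_of_nat_mult[of 3 "ln (real p)"] by simp
      then show ?thesis by (simp add: exp_minus inverse_eq_divide)
    qed
    also have "2 * real p * (1 / real p ^ 3) \<le> 1 / real p"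
      using p by (simp add: field_simps power3_eq_cube)
    finally show ?thesis .
  qed
  note dev = prob_ex_countable_le[OF T(1), where P = "\<lambda>t \<omega>. r < W t \<omega>", OF ev finite_le]
  define A where "A = space M - {\<omega> \<in> space M. \<exists>t\<in>T. r < W t \<omega>}"
  have A: "A \<in> events" unfolding A_def using dev(1) by blast
  have "1 - 1 / real p \<le> prob A"
    unfolding A_def using dev by (subst prob_compl) auto
  moreover have "W \<beta> \<omega> \<le> r" if AU: "\<omega> \<in> A" "\<beta> \<in> U" for \<omega> \<beta>
  proof (rule field_le_epsilon)
    fix e :: real assume e: "0 < e"
    \<comment> \<open>\<open>W\<close> varies by at most \<open>2 * n * D * K\<close> times the l1
      distance, each observation contributing once through its mean and once through its
      value.\<close>
    define e' where "e' = e / (2 * real n * D * K)"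
    have e': "0 < e'" using e n D K by (simp add: e'_def)
    have "open {t. l1_norm p (\<lambda>j. \<beta> j - t j) < e'}"
      unfolding l1_norm_def by (intro open_Collect_less continuous_intros continuous_on_product_coordinates)
    moreover have "\<beta> \<in> {t. l1_norm p (\<lambda>j. \<beta> j - t j) < e'}"
      using e' by (simp add: l1_norm_def)
    ultimately obtain t where t: "t \<in> T" "l1_norm p (\<lambda>j. \<beta> j - t j) < e'"
      using open_Int_closure_eq_empty[of "{t. l1_norm p (\<lambda>j. \<beta> j - t j) < e'}" T] T(3) AU(2) by blast
    define q where "q = D * (K * l1_norm p (\<lambda>j. \<beta> j - t j))"
    have \<Phi>: "\<beta> \<in> \<Phi>" "t \<in> \<Phi>" using t(1) T(2) AU(2) by (auto simp: U_def)
    have \<omega>: "\<omega> \<in> space M" "W t \<omega> \<le> r" using AU(1) t(1) by (auto simp: A_def not_less)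
    have "W \<beta> \<omega> - W t \<omega> \<le> (\<Sum>i=1..n. 2 * q)"
      unfolding W_def sum_subtractf[symmetric]
    proof (rule sum_mono)
      fix i assume i: "i \<in> {1..n}"
      have *: "\<bar>g \<beta> (Z i \<omega>) - g t (Z i \<omega>)\<bar> \<le> q" if "\<omega> \<in> space M" for \<omega>
        unfolding q_def using g_lip[OF \<Phi> sample_in[OF that i]] .
      have "expectation (\<lambda>\<omega>. g \<beta> (Z i \<omega>) - g t (Z i \<omega>)) \<le> q"
        using * by (intro integral_le_const AE_I2 Bochner_Integration.integrable_diff g_int i) (auto simp: abs_le_iff)
      then show "expectation (\<lambda>\<omega>. g \<beta> (Z i \<omega>)) - g \<beta> (Z i \<omega>) - (expectation (\<lambda>\<omega>. g t (Z i \<omega>)) - g t (Z i \<omega>)) \<le> 2 * q"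
        using *[OF \<omega>(1)] g_int[OF i] by (simp add: abs_le_iff)
    qed
    also have "\<dots> = 2 * real n * D * K * l1_norm p (\<lambda>j. \<beta> j - t j)"
      by (simp add: q_def)
    also have "\<dots> \<le> 2 * real n * D * K * e'"
      using t(2) n D K by (intro mult_left_mono) auto
    also have "\<dots> = e"
      using n D K by (simp add: e'_def)
    finally show "W \<beta> \<omega> \<le> r + e" using \<omega>(2) by simp
  qed
  ultimately show ?thesis
    using n A by (intro that[of A]) (auto simp: U_def W_eq r_def)
qed

text \<open>\<open>event\<close> treats every positive radius that is large enough for
  \<open>\<Delta>\<close> and compatible with locality. For positive \<open>\<Delta>\<close> the
  radius \<open>\<Delta> / lam0\<close> gives the claim at once; for \<open>\<Delta> = 0\<close> the
  bound survives the passage to shrinking radii.\<close>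

lemma oracle_inequality_whp:
  fixes K D \<eta> lam0 \<Delta> H :: real
  assumes K: "0 < K" "\<forall>j\<in>{1..p}. sup_norm (\<psi> j) \<le> ereal K"
    and loss: "\<forall>f\<in>F. \<forall>x. \<forall>y\<in>Y. \<rho> f (x, y) = \<gamma> y (f x) + c f"
    and D: "0 < D"
    and lip: "\<forall>x. \<forall>y\<in>Y. \<forall>\<beta>\<in>\<Phi>. \<forall>\<beta>'\<in>\<Phi>.
       \<bar>\<gamma> y (lin_comb p \<psi> \<beta> x) - \<gamma> y (lin_comb p \<psi> \<beta>' x)\<bar>
         \<le> D * \<bar>lin_comb p \<psi> \<beta> x - lin_comb p \<psi> \<beta>' x\<bar>"
    and p: "2 \<le> p" and n: "0 < n"
    and lam0: "lam0 = 5 * K * D * sqrt (ln (real p) / real n)" "8 * lam0 \<le> lam1"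
    and \<eta>: "0 < \<eta>" and G0: "G 0 = 0" and b: "b \<in> \<Phi>"
    and H: "conj_penalty N G p \<psi> lam1 lam2 b = ereal H"
    and \<Delta>: "2 * \<Delta> = 3 * excess_risk M n Z \<rho> f0 (lin_comb p \<psi> b) + 2 * H"
    and margin: "\<And>f. f \<in> F_local F f0 \<eta> \<Longrightarrow> G (N (\<lambda>x. f x - f0 x)) \<le> excess_risk M n Z \<rho> f0 f"
    and local_b: "lin_comb p \<psi> b \<in> F_local F f0 \<eta>"
    and nearby: "\<And>\<beta>. \<beta> \<in> Rvec p \<Longrightarrow> l1_norm p (\<lambda>j. \<beta> j - b j) \<le> \<Delta> / lam0 \<Longrightarrow> lin_comb p \<psi> \<beta> \<in> F_local F f0 \<eta>"
    and re: "0 < adaptive_re N p \<psi> lam1 lam2 b"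
  obtains A where "A \<in> sets M" "1 - 1 / real p \<le> measure M A"
    "\<And>\<omega>. \<omega> \<in> A \<Longrightarrow> excess_risk M n Z \<rho> f0 (lin_comb p \<psi> (\<beta>hat \<omega>)) + lam1 * l1_norm p (\<lambda>j. \<beta>hat \<omega> j - b j)
    + lam2 * (l2_norm p (\<lambda>j. restr (vsupp p b) (\<beta>hat \<omega>) j - restr (vsupp p b) b j))\<^sup>2 \<le> 4 * \<Delta>"
proof -
  define V where "V \<omega> = excess_risk M n Z \<rho> f0 (lin_comb p \<psi> (\<beta>hat \<omega>)) + lam1 * l1_norm p (\<lambda>j. \<beta>hat \<omega> j - b j)
    + lam2 * (l2_norm p (\<lambda>j. restr (vsupp p b) (\<beta>hat \<omega>) j - restr (vsupp p b) b j))\<^sup>2" for \<omega>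
  have \<psi>K: "\<bar>\<psi> j x\<bar> \<le> K" if "j \<in> {1..p}" for j x
    using K(2) that by (simp add: sup_norm_le_iff)
  have lam0_pos: "0 < lam0" using K D p n by (simp add: lam0)
  have H_nonneg: "0 \<le> H"
    using convex_conjugate_nonneg[of G, OF G0] H[symmetric] by (simp add: conj_penalty_def flip: ereal_less_eq(5))
  have \<Xi>_nonneg: "0 \<le> excess_risk M n Z \<rho> f0 (lin_comb p \<psi> b)"
    by (simp add: excess_risk_nonneg lin_comb_in_F)
  have \<Delta>_nonneg: "0 \<le> \<Delta>" using \<Delta> H_nonneg \<Xi>_nonneg by simp
  have event: "\<exists>A\<in>sets M. 1 - 1 / real p \<le> measure M A \<and> (\<forall>\<omega>\<in>A. V \<omega> \<le> 4 * (lam0 * B))"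
    if B: "0 < B" "\<Delta> \<le> lam0 * B"
      and nearby: "\<And>\<beta>. \<beta> \<in> Rvec p \<Longrightarrow> l1_norm p (\<lambda>j. \<beta> j - b j) \<le> B \<Longrightarrow> lin_comb p \<psi> \<beta> \<in> F_local F f0 \<eta>" for B
  proof -
    obtain A where A: "A \<in> sets M" "1 - 1 / real p \<le> measure M A"
      and dev: "\<And>\<omega> \<beta>. \<omega> \<in> A \<Longrightarrow> \<beta> \<in> \<Phi> \<Longrightarrow> l1_norm p (\<lambda>j. \<beta> j - b j) \<le> B \<Longrightarrow>
      (Pmean M n Z (\<rho> (lin_comb p \<psi> \<beta>)) - Pmean M n Z (\<rho> (lin_comb p \<psi> b)))
        - (Pn n Z \<omega> (\<rho> (lin_comb p \<psi> \<beta>)) - Pn n Z \<omega> (\<rho> (lin_comb p \<psi> b))) \<le> lam0 * B"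
      using uniform_deviation_event[OF K(1) \<psi>K loss D lip p n lam0(1) b B(1)] by blast
    have budget: "3 * excess_risk M n Z \<rho> f0 (lin_comb p \<psi> b) + 2 * H \<le> 2 * (lam0 * B)"
      using B(2) \<Delta> by simp
    have "V \<omega> \<le> 4 * (lam0 * B)" if "\<omega> \<in> A" for \<omega>
      unfolding V_def
      using sets.sets_into_space[OF A(1)] that
      by (intro oracle_inequality_of_deviation[OF _ b B(1) lam0_pos lam0(2) G0 H re budget margin local_b nearby dev]) auto
    then show ?thesis using A by blast
  qed
  have "\<exists>A\<in>sets M. 1 - 1 / real p \<le> measure M A \<and> (\<forall>\<omega>\<in>A. V \<omega> \<le> 4 * \<Delta>)"
  proof (cases "\<Delta> = 0")
    case False
    then show ?thesis
      using event[of "\<Delta> / lam0"] nearby \<Delta>_nonneg lam0_pos by simp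
  next
    case True
    \<comment> \<open>The l1 ball of radius \<open>\<eta> / K\<close> around the oracle is mapped
      into the sup-norm ball of radius \<open>\<eta>\<close>. This supplies locality where the
      hypothesis on neighbours speaks only of radius zero.\<close>
    define B where "B k = \<eta> / K / real (Suc k)" for k
    \<comment> \<open>A zero budget forces a zero excess risk, both summands being
      nonnegative.\<close>
    have f0: "lin_comb p \<psi> b = f0"
      using True \<Delta> H_nonneg \<Xi>_nonneg by (intro excess_risk_zero_imp lin_comb_in_F) simp
    have "\<exists>A\<in>sets M. 1 - 1 / real p \<le> measure M A \<and> (\<forall>\<omega>\<in>A. V \<omega> \<le> 4 * (lam0 * B k))" for k
    proof (rule event)
      show "0 < B k" using \<eta> K by (simp add: B_def)
      then show "\<Delta> \<le> lam0 * B k" using True lam0_pos by simp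
      fix \<beta> assume le: "l1_norm p (\<lambda>j. \<beta> j - b j) \<le> B k"
      have "B k \<le> \<eta> / K" unfolding B_def using \<eta> K by (simp add: divide_le_eq)
      with le have "l1_norm p (\<lambda>j. \<beta> j - b j) \<le> \<eta> / K" by simp
      then have le': "K * l1_norm p (\<lambda>j. \<beta> j - b j) \<le> \<eta>"
        using K(1) by (simp add: field_simps)
      have "\<bar>lin_comb p \<psi> \<beta> x - f0 x\<bar> \<le> \<eta>" for x
        unfolding f0[symmetric] lin_comb_diff
        using abs_lin_comb_le[of p \<psi> x K "\<lambda>j. \<beta> j - b j", OF \<psi>K] le' by simp
      then show "lin_comb p \<psi> \<beta> \<in> F_local F f0 \<eta>"
        by (simp add: F_local_def lin_comb_in_F sup_norm_le_iff)
    qed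
    then obtain A where A: "\<And>k. A k \<in> sets M" "\<And>k. 1 - 1 / real p \<le> measure M (A k)"
      and V: "\<And>k \<omega>. \<omega> \<in> A k \<Longrightarrow> V \<omega> \<le> 4 * (lam0 * B k)"
      by metis
    \<comment> \<open>A point of the limes superior lies in \<open>A k\<close> for arbitrarily large
      \<open>k\<close>, and the bounds there tend to \<open>0\<close>.\<close>
    have "V \<omega> \<le> 4 * \<Delta>" if \<omega>: "\<omega> \<in> (\<Inter>m. \<Union>k\<in>{m..}. A k)" for \<omega>
    proof -
      have "V \<omega> \<le> 4 * lam0 * (\<eta> / K) / real (Suc m)" for m
      proof -
        obtain k where k: "m \<le> k" "\<omega> \<in> A k" using \<omega> by auto
        have "V \<omega> \<le> 4 * (lam0 * B k)" using V k(2) .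
        also have "B k \<le> \<eta> / K / real (Suc m)"
          unfolding B_def using k(1) \<eta> K by (intro divide_left_mono) auto
        finally show ?thesis using lam0_pos by (simp add: mult_ac)
      qed
      moreover have "(\<lambda>m. 4 * lam0 * (\<eta> / K) / real (Suc m)) \<longlonglongrightarrow> 0"
        by (rule LIMSEQ_Suc[OF lim_const_over_n])
      ultimately have "V \<omega> \<le> 0"
        by (intro LIMSEQ_le_const) auto
      then show ?thesis using True by simp
    qed
    then show ?thesis
      using prob_limsup_ge[of A "1 - 1 / real p"] A by blast
  qed
  then show ?thesis
    using that unfolding V_def by blast
qed

text \<open>An infinite penalty makes the bound infinite, and the whole space serves as the event.
  For a finite one \<open>\<Delta>s\<close> and \<open>Ms\<close> are real, and the real-valued
  version applies.\<close>

lemma oracle_inequality_ereal: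
  fixes K D \<eta> lam0 :: real and \<Delta>s Ms :: ereal
  assumes K: "0 < K"
    and loss: "\<forall>f\<in>F. \<forall>x. \<forall>y\<in>Y. \<rho> f (x, y) = \<gamma> y (f x) + c f"
    and D: "0 < D"
    and lip: "\<forall>x. \<forall>y\<in>Y. \<forall>\<beta>\<in>\<Phi>. \<forall>\<beta>'\<in>\<Phi>.
       \<bar>\<gamma> y (lin_comb p \<psi> \<beta> x) - \<gamma> y (lin_comb p \<psi> \<beta>' x)\<bar>
         \<le> D * \<bar>lin_comb p \<psi> \<beta> x - lin_comb p \<psi> \<beta>' x\<bar>"
    and \<psi>: "\<forall>j\<in>{1..p}. sup_norm (\<psi> j) \<le> ereal K"
    and p: "2 \<le> p" and n: "ln (real p) \<le> real n"
    and lam0: "lam0 = 5 * K * D * sqrt (ln (real p) / real n)" "8 * lam0 \<le> lam1"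
    and \<eta>: "0 < \<eta>" and G0: "G 0 = 0" and b: "b \<in> \<Phi>"
    and \<Delta>s: "2 * \<Delta>s = 3 * ereal (excess_risk M n Z \<rho> f0 (lin_comb p \<psi> b)) + 2 * conj_penalty N G p \<psi> lam1 lam2 b"
    and Ms: "Ms = \<Delta>s / ereal lam0"
    and margin: "\<forall>f\<in>F_local F f0 \<eta>. G (N (\<lambda>x. f x - f0 x)) \<le> excess_risk M n Z \<rho> f0 f"
    and local_b: "lin_comb p \<psi> b \<in> F_local F f0 \<eta>"
    and nearby: "\<forall>\<beta>\<in>Rvec p. ereal (l1_norm p (\<lambda>j. \<beta> j - b j)) \<le> Ms \<longrightarrow> lin_comb p \<psi> \<beta> \<in> F_local F f0 \<eta>"
    and re: "0 < adaptive_re N p \<psi> lam1 lam2 b"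
  shows "(\<exists>A\<in>sets M. measure M A \<ge> 1 - 1 / real p \<and>
       (\<forall>\<omega>\<in>A.
          ereal (excess_risk M n Z \<rho> f0 (lin_comb p \<psi> (\<beta>hat \<omega>))
                 + lam1 * l1_norm p (\<lambda>j. \<beta>hat \<omega> j - b j)
                 + lam2 * (l2_norm p (\<lambda>j. restr (vsupp p b) (\<beta>hat \<omega>) j - restr (vsupp p b) b j))\<^sup>2)
            \<le> 4 * \<Delta>s)) \<and>
    4 * \<Delta>s = 6 * ereal (excess_risk M n Z \<rho> f0 (lin_comb p \<psi> b)) + 4 * conj_penalty N G p \<psi> lam1 lam2 b"
proof -
  have "0 \<le> conj_penalty N G p \<psi> lam1 lam2 b"
    unfolding conj_penalty_def using G0 by (rule convex_conjugate_nonneg)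
  then consider H where "conj_penalty N G p \<psi> lam1 lam2 b = ereal H"
    | "conj_penalty N G p \<psi> lam1 lam2 b = \<infinity>"
    by (cases "conj_penalty N G p \<psi> lam1 lam2 b") auto
  then show ?thesis
  proof cases
    case (1 H)
    define \<Xi> where "\<Xi> = excess_risk M n Z \<rho> f0 (lin_comb p \<psi> b)"
    have "2 * \<Delta>s = ereal (3 * \<Xi> + 2 * H)"
      unfolding \<Delta>s 1 \<Xi>_def[symmetric] by simp
    then obtain \<Delta> where \<Delta>: "\<Delta>s = ereal \<Delta>" "2 * \<Delta> = 3 * \<Xi> + 2 * H"
      by (cases \<Delta>s) simp_all
    \<comment> \<open>\<open>p \<ge> 2\<close> makes \<open>ln p\<close> positive, so the bound by
      \<open>n\<close> excludes an empty sample.\<close>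
    have n': "0 < n" using n p ln_gt_zero[of "real p"] by (cases n) auto
    have "0 < lam0" using K D p n' by (simp add: lam0)
    then have "Ms = ereal (\<Delta> / lam0)" by (simp add: Ms \<Delta>)
    with nearby have nearby': "lin_comb p \<psi> \<beta> \<in> F_local F f0 \<eta>"
      if "\<beta> \<in> Rvec p" "l1_norm p (\<lambda>j. \<beta> j - b j) \<le> \<Delta> / lam0" for \<beta>
      using that by simp
    from margin have margin': "G (N (\<lambda>x. f x - f0 x)) \<le> excess_risk M n Z \<rho> f0 f"
      if "f \<in> F_local F f0 \<eta>" for f
      using that by blast
    obtain A where "A \<in> sets M" "1 - 1 / real p \<le> measure M A"
      "\<And>\<omega>. \<omega> \<in> A \<Longrightarrow> excess_risk M n Z \<rho> f0 (lin_comb p \<psi> (\<beta>hat \<omega>)) + lam1 * l1_norm p (\<lambda>j. \<beta>hat \<omega> j - b j)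
      + lam2 * (l2_norm p (\<lambda>j. restr (vsupp p b) (\<beta>hat \<omega>) j - restr (vsupp p b) b j))\<^sup>2 \<le> 4 * \<Delta>"
      using oracle_inequality_whp[OF K \<psi> loss D lip p n' lam0 \<eta> G0 b 1 \<Delta>(2)[unfolded \<Xi>_def]
          margin' local_b nearby' re]
      by blast
    moreover have "4 * \<Delta>s = 6 * ereal \<Xi> + 4 * ereal H"
      using \<Delta>(2) by (simp add: \<Delta>(1))
    ultimately show ?thesis
      unfolding 1 \<Xi>_def \<Delta>(1) by auto
  next
    case 2
    have "2 * \<Delta>s = \<infinity>" unfolding \<Delta>s 2 by simp
    then have "\<Delta>s = \<infinity>" by (cases \<Delta>s) simp_all
    then show ?thesis
      unfolding 2 by (auto simp: prob_space intro!: bexI[of _ "space M"])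
  qed
qed

end

theorem theorem3:
  fixes K :: real
  assumes "K > 0"
  shows "\<exists>d>0. \<forall>(M :: 'w measure) (MX :: 'x measure) Y n Z F N \<rho> f0 p \<psi> \<Phi> lam1 lam2 \<beta>hat
            \<gamma> c D lam0 \<eta> G \<Gamma> \<beta>s \<Delta>s Ms.
    elastic_net M MX Y n Z F N \<rho> f0 p \<psi> \<Phi> lam1 lam2 \<beta>hat \<longrightarrow>
    (\<forall>f\<in>F. \<forall>x. \<forall>y\<in>Y. \<rho> f (x, y) = \<gamma> y (f x) + c f) \<longrightarrow>
    D > 0 \<longrightarrow>
    (\<forall>x. \<forall>y\<in>Y. \<forall>\<beta>\<in>\<Phi>. \<forall>\<beta>'\<in>\<Phi>.
       \<bar>\<gamma> y (lin_comb p \<psi> \<beta> x) - \<gamma> y (lin_comb p \<psi> \<beta>' x)\<bar>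
         \<le> D * \<bar>lin_comb p \<psi> \<beta> x - lin_comb p \<psi> \<beta>' x\<bar>) \<longrightarrow>
    (\<Sum>i=1..n. MAX j\<in>{1..p}. (\<integral>\<omega>. (\<psi> j (fst (Z i \<omega>)))\<^sup>2 \<partial>M)) / real n \<le> 1 \<longrightarrow>
    (\<forall>j\<in>{1..p}. sup_norm (\<psi> j) \<le> ereal K) \<longrightarrow>
    p \<ge> 2 \<longrightarrow>
    ln (real p) \<le> real n \<longrightarrow>
    lam0 = d * D * sqrt (ln (real p) / real n) \<longrightarrow>
    lam1 \<ge> 8 * lam0 \<longrightarrow>
    \<eta> > 0 \<longrightarrow>
    strictly_convex_nonneg G \<longrightarrow>
    G 0 = 0 \<longrightarrow>
    \<Gamma> \<subseteq> Pow {1..p} \<longrightarrow>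
    is_arg_min
      (\<lambda>\<beta>. 3 * ereal (excess_risk M n Z \<rho> f0 (lin_comb p \<psi> \<beta>)) + 2 * conj_penalty N G p \<psi> lam1 lam2 \<beta>)
      (\<lambda>\<beta>. \<beta> \<in> Rvec p \<and> vsupp p \<beta> \<in> \<Gamma>) \<beta>s \<longrightarrow>
    \<beta>s \<in> \<Phi> \<longrightarrow>
    2 * \<Delta>s = 3 * ereal (excess_risk M n Z \<rho> f0 (lin_comb p \<psi> \<beta>s)) + 2 * conj_penalty N G p \<psi> lam1 lam2 \<beta>s \<longrightarrow>
    Ms = \<Delta>s / ereal lam0 \<longrightarrow>
    (\<forall>f\<in>F_local F f0 \<eta>. excess_risk M n Z \<rho> f0 f \<ge> G (N (\<lambda>x. f x - f0 x))) \<longrightarrow>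
    lin_comb p \<psi> \<beta>s \<in> F_local F f0 \<eta> \<longrightarrow>
    (\<forall>\<beta>\<in>Rvec p. ereal (l1_norm p (\<lambda>j. \<beta> j - \<beta>s j)) \<le> Ms \<longrightarrow> lin_comb p \<psi> \<beta> \<in> F_local F f0 \<eta>) \<longrightarrow>
    adaptive_re N p \<psi> lam1 lam2 \<beta>s > 0 \<longrightarrow>
    (\<exists>A\<in>sets M. measure M A \<ge> 1 - 1 / real p \<and>
       (\<forall>\<omega>\<in>A.
          ereal (excess_risk M n Z \<rho> f0 (lin_comb p \<psi> (\<beta>hat \<omega>))
                 + lam1 * l1_norm p (\<lambda>j. \<beta>hat \<omega> j - \<beta>s j)
                 + lam2 * (l2_norm p (\<lambda>j. restr (vsupp p \<beta>s) (\<beta>hat \<omega>) j - restr (vsupp p \<beta>s) \<beta>s j))\<^sup>2)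
            \<le> 4 * \<Delta>s)) \<and>
    4 * \<Delta>s = 6 * ereal (excess_risk M n Z \<rho> f0 (lin_comb p \<psi> \<beta>s)) + 4 * conj_penalty N G p \<psi> lam1 lam2 \<beta>s"
proof (intro exI[of _ "5 * K"] conjI[OF _ allI] allI impI)
  \<comment> \<open>The witness depends on \<open>K\<close> alone and is fixed before the model. The
    factor \<open>5\<close> makes the tail exponent exceed \<open>3\<close>; a factor
    \<open>4\<close> would leave \<open>2 / p\<close> as the failure probability.\<close>
  show "0 < 5 * K" using assms by simp
qed (rule elastic_net.oracle_inequality_ereal[OF _ assms]; assumption)

end
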